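(* Let $\mathcal X=(\Omega,S)$ be a quasi-thin scheme that is not Kleinian, has degree $|\Omega|\ge 9$, and satisfies $|S^\perp|\ge 2$. Then for every scheme $\mathcal X'=(\Omega',S')$, every algebraic isomorphism $\varphi:\mathcal X\to\mathcal X'$ and every pair of points $\alpha\in\Omega$, $\alpha'\in\Omega'$, there exists a one point extension $\varphi_{\alpha,\alpha'}:\mathcal X_\alpha\to\mathcal X'_{\alpha'}$ of $\varphi$.
   Context: A coherent configuration is a pair $(\Omega,S)$ with $\Omega$ finite and $S$ a partition of $\Omega\times\Omega$ such that $1_\Omega$ is a union of elements of $S$, $S$ is closed under transposition $r\mapsto r^*$, and for $u,v,w\in S$ the number $c_{uv}^w=|\alpha u\cap\gamma v^*|$ is independent of $(\alpha,\gamma)\in w$; it is a scheme if $1_\Omega\in S$; its degree is $|\Omega|$. Quasi-thin: every basic relation has valency $|\alpha u|\in\{1,2\}$; $S_m$ = basic relations of valency $m$. For $u,v\in S$, $uv$ is the set of basic relations contained in the relational product $u\cdot v$. $T\subseteq S$ is closed if $uv^*\subseteq T$ for $u,v\in T$; the thin residue is the intersection of all closed subsets containing $\bigcup_{u\in S}uu^*$; the scheme is Kleinian if its thin residue is contained in $S_1$ and forms a Klein four-group under relational product. For $u\in S_2$ there is a unique basic relation $u^\perp$ with $uu^*=\{1_\Omega,u^\perp\}$; $S^\perp=\{u^\perp:u\in S_2\}$. An algebraic isomorphism is a bijection $\varphi:S\to S'$ with $c_{uv}^w=c_{\varphi(u)\varphi(v)}^{\varphi(w)}$. For $\alpha\in\Omega$,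 $\mathcal X_\alpha=(\Omega,S_\alpha)$ is the smallest coherent configuration on $\Omega$ with $1_\alpha=\{(\alpha,\alpha)\}\in S_\alpha$ and every element of $S$ a union of elements of $S_\alpha$. A one point extension of $\varphi$ at $(\alpha,\alpha')$ is an algebraic isomorphism $\varphi':\mathcal X_\alpha\to\mathcal X'_{\alpha'}$ with $\varphi'(1_\alpha)=1_{\alpha'}$ and $\varphi'(u)\subseteq\varphi(\tilde u)$ for all $u\in S_\alpha$, where $\tilde u$ is the basic relation of $\mathcal X$ containing $u$. *)

theory Defs
  imports "HOL-Library.Disjoint_Sets" "HOL-Algebra.Elementary_Groups"
begin

section \<open>Coherent configurations and schemes\<close>

text \<open>
  Relations on \<open>\<Omega>\<close> are sets of pairs, so that \<open>\<alpha>u\<close> is \<open>u `` {\<alpha>}\<close>, the transpose \<open>u\<^sup>*\<close> is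
  \<open>converse u\<close>, the relation \<open>1\<^bsub>\<Omega>\<^esub>\<close> is \<open>Id_on \<Omega>\<close>, and the relational product \<open>u \<cdot> v\<close> is \<open>u O v\<close>
  (first \<open>u\<close>, then \<open>v\<close>).
\<close>

definition is_union :: "'c set set \<Rightarrow> 'c set \<Rightarrow> bool" where
  "is_union S x \<longleftrightarrow> (\<exists>R\<subseteq>S. x = \<Union>R)"

definition coherent_configuration :: "'a set \<Rightarrow> 'a rel set \<Rightarrow> bool" where
  "coherent_configuration \<Omega> S \<longleftrightarrow>
     finite \<Omega> \<and>
     partition_on (\<Omega> \<times> \<Omega>) S \<and>
     is_union S (Id_on \<Omega>) \<and>
     (\<forall>u\<in>S. converse u \<in> S) \<and>
     (\<forall>u\<in>S. \<forall>v\<in>S. \<forall>w\<in>S. \<exists>c. \<forall>(\<alpha>, \<gamma>)\<in>w. card (u `` {\<alpha>} \<inter> converse v `` {\<gamma>}) = c)"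

definition intersection_number :: "'a rel \<Rightarrow> 'a rel \<Rightarrow> 'a rel \<Rightarrow> nat" where
  "intersection_number u v w =
     (THE c. \<forall>(\<alpha>, \<gamma>)\<in>w. card (u `` {\<alpha>} \<inter> converse v `` {\<gamma>}) = c)"

definition scheme :: "'a set \<Rightarrow> 'a rel set \<Rightarrow> bool" where
  "scheme \<Omega> S \<longleftrightarrow> coherent_configuration \<Omega> S \<and> Id_on \<Omega> \<in> S"


section \<open>Quasi-thin and Kleinian schemes\<close>

definition quasi_thin :: "'a set \<Rightarrow> 'a rel set \<Rightarrow> bool" where
  "quasi_thin \<Omega> S \<longleftrightarrow> (\<forall>u\<in>S. \<forall>\<alpha>\<in>\<Omega>. card (u `` {\<alpha>}) \<in> {1, 2})"

definition valency_part :: "'a set \<Rightarrow> 'a rel set \<Rightarrow> nat \<Rightarrow> 'a rel set" where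
  "valency_part \<Omega> S m = {u \<in> S. \<forall>\<alpha>\<in>\<Omega>. card (u `` {\<alpha>}) = m}"

definition complex_product :: "'a rel set \<Rightarrow> 'a rel \<Rightarrow> 'a rel \<Rightarrow> 'a rel set" where
  "complex_product S u v = {w \<in> S. w \<subseteq> u O v}"

definition closed_subset :: "'a rel set \<Rightarrow> 'a rel set \<Rightarrow> bool" where
  "closed_subset S T \<longleftrightarrow>
     T \<subseteq> S \<and> (\<forall>u\<in>T. \<forall>v\<in>T. complex_product S u (converse v) \<subseteq> T)"

definition thin_residue :: "'a rel set \<Rightarrow> 'a rel set" where
  "thin_residue S =
     \<Inter>{T. closed_subset S T \<and> (\<Union>u\<in>S. complex_product S u (converse u)) \<subseteq> T}"

definition relation_monoid :: "'a set \<Rightarrow> 'a rel set \<Rightarrow> 'a rel monoid" where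
  "relation_monoid \<Omega> T = \<lparr>carrier = T, mult = (O), one = Id_on \<Omega>\<rparr>"

definition klein_four_group :: "'c monoid \<Rightarrow> bool" where
  "klein_four_group G \<longleftrightarrow>
     group G \<and> G \<cong> (integer_mod_group 2 \<times>\<times> integer_mod_group 2)"

definition kleinian :: "'a set \<Rightarrow> 'a rel set \<Rightarrow> bool" where
  "kleinian \<Omega> S \<longleftrightarrow>
     thin_residue S \<subseteq> valency_part \<Omega> S 1 \<and>
     klein_four_group (relation_monoid \<Omega> (thin_residue S))"

definition perp :: "'a set \<Rightarrow> 'a rel set \<Rightarrow> 'a rel \<Rightarrow> 'a rel" where
  "perp \<Omega> S u = (THE v. v \<in> S \<and> complex_product S u (converse u) = {Id_on \<Omega>, v})"

definition perp_set :: "'a set \<Rightarrow> 'a rel set \<Rightarrow> 'a rel set" where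
  "perp_set \<Omega> S = perp \<Omega> S ` valency_part \<Omega> S 2"


section \<open>Algebraic isomorphisms and one point extensions\<close>

definition algebraic_isomorphism :: "'a rel set \<Rightarrow> 'b rel set \<Rightarrow> ('a rel \<Rightarrow> 'b rel) \<Rightarrow> bool" where
  "algebraic_isomorphism S S' \<phi> \<longleftrightarrow>
     bij_betw \<phi> S S' \<and>
     (\<forall>u\<in>S. \<forall>v\<in>S. \<forall>w\<in>S.
        intersection_number u v w = intersection_number (\<phi> u) (\<phi> v) (\<phi> w))"

definition extends_at :: "'a set \<Rightarrow> 'a rel set \<Rightarrow> 'a \<Rightarrow> 'a rel set \<Rightarrow> bool" where
  "extends_at \<Omega> S \<alpha> T \<longleftrightarrow>
     coherent_configuration \<Omega> T \<and> {(\<alpha>, \<alpha>)} \<in> T \<and> (\<forall>u\<in>S. is_union T u)"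

text \<open>
  \<open>S\<^sub>\<alpha>\<close>: the smallest configuration, i.e. the one whose basic relations are unions of basic
  relations of every other candidate. Existence and uniqueness are shown in
  \<open>point_extension_least\<close> and \<open>point_extension_unique\<close>.
\<close>

definition point_extension :: "'a set \<Rightarrow> 'a rel set \<Rightarrow> 'a \<Rightarrow> 'a rel set" where
  "point_extension \<Omega> S \<alpha> =
     (THE T. extends_at \<Omega> S \<alpha> T \<and>
             (\<forall>T'. extends_at \<Omega> S \<alpha> T' \<longrightarrow> (\<forall>u\<in>T. is_union T' u)))"

text \<open>
  Below, \<open>v\<close> plays the role of the basic relation of \<open>S\<close> that contains \<open>u\<close>.
\<close>

definition one_point_extension ::
    "'a set \<Rightarrow> 'a rel set \<Rightarrow> 'b set \<Rightarrow> 'b rel set \<Rightarrow> ('a rel \<Rightarrow> 'b rel) \<Rightarrow>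
     'a \<Rightarrow> 'b \<Rightarrow> ('a rel \<Rightarrow> 'b rel) \<Rightarrow> bool" where
  "one_point_extension \<Omega> S \<Omega>' S' \<phi> \<alpha> \<alpha>' \<psi> \<longleftrightarrow>
     algebraic_isomorphism (point_extension \<Omega> S \<alpha>) (point_extension \<Omega>' S' \<alpha>') \<psi> \<and>
     \<psi> {(\<alpha>, \<alpha>)} = {(\<alpha>', \<alpha>')} \<and>
     (\<forall>u\<in>point_extension \<Omega> S \<alpha>. \<forall>v\<in>S. u \<subseteq> v \<longrightarrow> \<psi> u \<subseteq> \<phi> v)"


section \<open>Existence and uniqueness of the point extension\<close>

lemma partition_block_unique:
  "partition_on A T \<Longrightarrow> s \<in> T \<Longrightarrow> t \<in> T \<Longrightarrow> x \<in> s \<Longrightarrow> x \<in> t \<Longrightarrow> s = t"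
  by (auto simp: partition_on_def disjoint_def)

lemma partition_eq_if_mutual_unions:
  assumes T: "partition_on A T" and T': "partition_on A T'"
    and TT': "\<forall>u\<in>T. is_union T' u" and T'T: "\<forall>u\<in>T'. is_union T u"
  shows "T \<subseteq> T'"
proof
  fix u assume u: "u \<in> T"
  then obtain x where x: "x \<in> u" using partition_onD3[OF T] by (metis ex_in_conv)
  obtain v where v: "v \<in> T'" "x \<in> v" "v \<subseteq> u"
    using TT' u x by (fastforce simp: is_union_def)
  obtain w where w: "w \<in> T" "x \<in> w" "w \<subseteq> v"
    using T'T v by (fastforce simp: is_union_def)
  have "w = u" using partition_block_unique[OF T w(1) u w(2) x] .
  then have "u = v" using v w by blast
  then show "u \<in> T'" using v by simp
qed

lemma union_iff_saturated:
  assumes "partition_on A T" "x \<subseteq> A"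
  shows "is_union T x \<longleftrightarrow> (\<forall>t\<in>T. t \<inter> x \<noteq> {} \<longrightarrow> t \<subseteq> x)"
proof
  assume "is_union T x"
  then obtain R where R: "R \<subseteq> T" "x = \<Union>R" by (auto simp: is_union_def)
  show "\<forall>t\<in>T. t \<inter> x \<noteq> {} \<longrightarrow> t \<subseteq> x"
  proof (intro ballI impI)
    fix t assume t: "t \<in> T" "t \<inter> x \<noteq> {}"
    then obtain y r where "y \<in> t" "r \<in> R" "y \<in> r" using R by blast
    then have "t = r" using partition_block_unique[OF assms(1) t(1)] R by blast
    then show "t \<subseteq> x" using R \<open>r \<in> R\<close> by blast
  qed
next
  assume *: "\<forall>t\<in>T. t \<inter> x \<noteq> {} \<longrightarrow> t \<subseteq> x"
  have "x = \<Union>{t \<in> T. t \<subseteq> x}"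
  proof (rule Set.set_eqI, rule iffI)
    fix y assume y: "y \<in> x"
    then obtain t where "t \<in> T" "y \<in> t" using assms partition_onD1 by blast
    then show "y \<in> \<Union>{t \<in> T. t \<subseteq> x}" using * y by blast
  qed blast
  then show "is_union T x"
    unfolding is_union_def by (intro exI[of _ "{t \<in> T. t \<subseteq> x}"] conjI) auto
qed

lemma regular_on_unions:
  assumes cc: "coherent_configuration \<Omega> T" and u: "is_union T u" and v: "is_union T v"
    and t: "t \<in> T" "(a, b) \<in> t" "(a', b') \<in> t"
  shows "card (u `` {a} \<inter> converse v `` {b}) = card (u `` {a'} \<inter> converse v `` {b'})"
proof -
  from cc have fin: "finite \<Omega>" and part: "partition_on (\<Omega> \<times> \<Omega>) T"
    by (auto simp: coherent_configuration_def)
  have reg: "card (p `` {a} \<inter> converse q `` {b}) = card (p `` {a'} \<inter> converse q `` {b'})"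
    if "p \<in> T" "q \<in> T" for p q
  proof -
    have "\<exists>c. \<forall>(x, y)\<in>t. card (p `` {x} \<inter> converse q `` {y}) = c"
      using cc that t(1) unfolding coherent_configuration_def by blast
    then obtain c where "\<forall>(x, y)\<in>t. card (p `` {x} \<inter> converse q `` {y}) = c" ..
    from bspec[OF this t(2)] bspec[OF this t(3)] show ?thesis by simp
  qed
  obtain P where P: "P \<subseteq> T" "u = \<Union>P" using u by (auto simp: is_union_def)
  obtain Q where Q: "Q \<subseteq> T" "v = \<Union>Q" using v by (auto simp: is_union_def)
  have sub: "\<And>p. p \<in> T \<Longrightarrow> p \<subseteq> \<Omega> \<times> \<Omega>" using part by (auto simp: partition_on_def)
  have "finite T" using finite_elements[OF _ part] fin by simp
  then have finPQ: "finite (P \<times> Q)" using P Q by (simp add: finite_subset)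
  have count: "card (u `` {c} \<inter> converse v `` {d}) =
      (\<Sum>(p, q)\<in>P \<times> Q. card (p `` {c} \<inter> converse q `` {d}))" for c d
  proof -
    have eq: "u `` {c} \<inter> converse v `` {d} =
        (\<Union>x\<in>P \<times> Q. fst x `` {c} \<inter> converse (snd x) `` {d})"
      unfolding P(2) Q(2) by auto
    have "card (\<Union>x\<in>P \<times> Q. fst x `` {c} \<inter> converse (snd x) `` {d}) =
        (\<Sum>x\<in>P \<times> Q. card (fst x `` {c} \<inter> converse (snd x) `` {d}))"
    proof (rule card_UN_disjoint[OF finPQ])
      show "\<forall>x\<in>P \<times> Q. finite (fst x `` {c} \<inter> converse (snd x) `` {d})"
      proof
        fix x assume "x \<in> P \<times> Q"
        then have "fst x `` {c} \<subseteq> \<Omega>" using sub P by fastforce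
        then show "finite (fst x `` {c} \<inter> converse (snd x) `` {d})"
          using fin finite_subset by blast
      qed
      show "\<forall>x\<in>P \<times> Q. \<forall>y\<in>P \<times> Q. x \<noteq> y \<longrightarrow>
          (fst x `` {c} \<inter> converse (snd x) `` {d}) \<inter>
          (fst y `` {c} \<inter> converse (snd y) `` {d}) = {}"
      proof (intro ballI impI, rule ccontr)
        fix x y assume xy: "x \<in> P \<times> Q" "y \<in> P \<times> Q" "x \<noteq> y"
          and "(fst x `` {c} \<inter> converse (snd x) `` {d}) \<inter>
               (fst y `` {c} \<inter> converse (snd y) `` {d}) \<noteq> {}"
        then obtain z where z: "(c, z) \<in> fst x" "(c, z) \<in> fst y"
            "(z, d) \<in> snd x" "(z, d) \<in> snd y" by blast
        have "fst x \<in> T" "fst y \<in> T" "snd x \<in> T" "snd y \<in> T"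
          using xy(1,2) P(1) Q(1) by (auto simp: mem_Times_iff)
        then have "fst x = fst y" "snd x = snd y"
          using partition_block_unique[OF part _ _ z(1,2)]
            partition_block_unique[OF part _ _ z(3,4)] by simp_all
        then show False using xy by (simp add: prod_eq_iff)
      qed
    qed
    then show ?thesis by (simp add: eq case_prod_beta)
  qed
  show ?thesis
    unfolding count by (rule sum.cong) (use reg P Q in auto)
qed

lemma discrete_extends_at:
  assumes "coherent_configuration \<Omega> S" "\<alpha> \<in> \<Omega>"
  shows "extends_at \<Omega> S \<alpha> ((\<lambda>x. {x}) ` (\<Omega> \<times> \<Omega>))"
proof -
  let ?D = "(\<lambda>x. {x}) ` (\<Omega> \<times> \<Omega>)"
  have un: "is_union ?D u" if "u \<subseteq> \<Omega> \<times> \<Omega>" for u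
    unfolding is_union_def by (rule exI[of _ "(\<lambda>x. {x}) ` u"]) (use that in auto)
  have "converse u \<in> ?D" if "u \<in> ?D" for u
  proof -
    from that obtain a b where "u = {(a, b)}" "a \<in> \<Omega>" "b \<in> \<Omega>" by auto
    then have "converse u = {(b, a)}" "(b, a) \<in> \<Omega> \<times> \<Omega>" by auto
    then show ?thesis by blast
  qed
  then have "coherent_configuration \<Omega> ?D"
    using assms(1) un[of "Id_on \<Omega>"] partition_on_singletons[of "\<Omega> \<times> \<Omega>"]
    by (auto simp: coherent_configuration_def)
  moreover have "u \<subseteq> \<Omega> \<times> \<Omega>" if "u \<in> S" for u
    using assms(1) that by (auto simp: coherent_configuration_def partition_on_def)
  ultimately show ?thesis using un assms(2) by (auto simp: extends_at_def)
qed

lemma least_extension_exists: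
  assumes S: "coherent_configuration \<Omega> S" and \<alpha>: "\<alpha> \<in> \<Omega>"
  shows "\<exists>T. extends_at \<Omega> S \<alpha> T \<and>
             (\<forall>T'. extends_at \<Omega> S \<alpha> T' \<longrightarrow> (\<forall>u\<in>T. is_union T' u))"
proof -
  define F where "F = {T. extends_at \<Omega> S \<alpha> T}"
  define E where "E = (\<Union>T\<in>F. {(x, y). \<exists>t\<in>T. x \<in> t \<and> y \<in> t})"
  define A where "A = \<Omega> \<times> \<Omega>"
  have F: "coherent_configuration \<Omega> T" "partition_on A T" "{(\<alpha>, \<alpha>)} \<in> T"
      "\<And>u. u \<in> S \<Longrightarrow> is_union T u" "is_union T (Id_on \<Omega>)"
      "\<And>u. u \<in> T \<Longrightarrow> converse u \<in> T" if "T \<in> F" for T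
    using that by (auto simp: F_def extends_at_def coherent_configuration_def A_def)
  have D: "(\<lambda>x. {x}) ` (\<Omega> \<times> \<Omega>) \<in> F"
    using discrete_extends_at[OF S \<alpha>] by (simp add: F_def)
  have EA: "E \<subseteq> A \<times> A"
    using F(2) by (fastforce simp: E_def partition_on_def)
  have equiv: "equiv A (E\<^sup>+)"
  proof (rule equivI)
    show "E\<^sup>+ \<subseteq> A \<times> A" using EA by (rule trancl_subset_Sigma)
    have "(x, x) \<in> E" if "x \<in> A" for x
      unfolding E_def using that by (auto simp: A_def intro!: bexI[OF _ D])
    then show "refl_on A (E\<^sup>+)" by (auto simp: refl_on_def)
    have "sym E" by (auto simp: E_def sym_def)
    then show "sym (E\<^sup>+)" by (rule sym_trancl)
  qed simp
  define M where "M = A // E\<^sup>+"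
  have M: "partition_on A M" unfolding M_def using equiv by (rule partition_on_quotient)
  have satM: "is_union M x"
    if x: "x \<subseteq> A" and un: "\<And>T. T \<in> F \<Longrightarrow> is_union T x" for x
  proof -
    have step: "b \<in> x" if "(a, b) \<in> E" "a \<in> x" for a b
    proof -
      obtain T t where T: "T \<in> F" "t \<in> T" "a \<in> t" "b \<in> t" using \<open>(a, b) \<in> E\<close> by (auto simp: E_def)
      then show ?thesis
        using union_iff_saturated[OF F(2)[OF T(1)] x] un[OF T(1)] \<open>a \<in> x\<close> by blast
    qed
    have "b \<in> x" if "(a, b) \<in> E\<^sup>+" "a \<in> x" for a b
      using that by (induction rule: trancl_induct) (auto intro: step)
    moreover have "(a, b) \<in> E\<^sup>+" if "t \<in> M" "a \<in> t" "b \<in> t" for t a b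
      using quotient_eq_iff[OF equiv, of t t a b] that by (auto simp: M_def)
    ultimately show ?thesis
      unfolding union_iff_saturated[OF M x] by blast
  qed
  have MT: "is_union T u" if u: "u \<in> M" and T: "T \<in> F" for u T
  proof -
    have uA: "u \<subseteq> A" using M u by (auto simp: partition_on_def)
    show ?thesis unfolding union_iff_saturated[OF F(2)[OF T] uA]
    proof (intro ballI impI subsetI)
      fix t y assume t: "t \<in> T" "t \<inter> u \<noteq> {}" "y \<in> t"
      then obtain z where z: "z \<in> t" "z \<in> u" by blast
      then have "(z, y) \<in> E" using t T by (auto simp: E_def)
      then show "y \<in> u"
        using in_quotient_imp_closed[OF equiv _ z(2)] u by (simp add: M_def r_into_trancl')
    qed
  qed
  have "extends_at \<Omega> S \<alpha> M"
    unfolding extends_at_def coherent_configuration_def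
  proof (intro conjI ballI)
    show "finite \<Omega>" using S by (simp add: coherent_configuration_def)
    show "partition_on (\<Omega> \<times> \<Omega>) M" using M by (simp add: A_def)
    show "is_union M (Id_on \<Omega>)" by (rule satM) (auto simp: A_def F)
    show "is_union M u" if "u \<in> S" for u
    proof (rule satM)
      show "u \<subseteq> A" using S that by (auto simp: coherent_configuration_def partition_on_def A_def)
    qed (rule F(4)[OF _ that])
    have "is_union M {(\<alpha>, \<alpha>)}"
    proof (rule satM)
      show "is_union T {(\<alpha>, \<alpha>)}" if "T \<in> F" for T
        unfolding is_union_def by (rule exI[of _ "{{(\<alpha>, \<alpha>)}}"]) (use F(3)[OF that] in auto)
    qed (use \<alpha> in \<open>auto simp: A_def\<close>)
    then obtain R where R: "R \<subseteq> M" "{(\<alpha>, \<alpha>)} = \<Union>R" by (auto simp: is_union_def)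
    then obtain r where r: "r \<in> R" "(\<alpha>, \<alpha>) \<in> r" by blast
    then have "r = {(\<alpha>, \<alpha>)}" using R by blast
    then show "{(\<alpha>, \<alpha>)} \<in> M" using r R by blast
    show "converse u \<in> M" if u: "u \<in> M" for u
    proof -
      have E_swap: "((b, a), (d, c)) \<in> E" if "((a, b), (c, d)) \<in> E" for a b c d
      proof -
        obtain T t where T: "T \<in> F" "t \<in> T" "(a, b) \<in> t" "(c, d) \<in> t"
          using \<open>((a, b), (c, d)) \<in> E\<close> by (auto simp: E_def)
        then show ?thesis unfolding E_def using F(6)[OF T(1,2)] by blast
      qed
      have swap: "(prod.swap x, prod.swap y) \<in> E\<^sup>+" if "(x, y) \<in> E\<^sup>+" for x y
        using that
      proof (induction rule: trancl_induct)
        case (base y) then show ?case using E_swap by (cases x; cases y) auto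
      next
        case (step y z)
        have "(prod.swap y, prod.swap z) \<in> E" using step(2) E_swap by (cases y; cases z) auto
        then show ?case using step(3) by (rule trancl.trancl_into_trancl[rotated])
      qed
      obtain x where x: "x \<in> A" "u = E\<^sup>+ `` {x}" using u by (auto simp: M_def quotient_def)
      have "converse u = E\<^sup>+ `` {prod.swap x}"
      proof (rule Set.set_eqI)
        fix y
        have "y \<in> converse u \<longleftrightarrow> (x, prod.swap y) \<in> E\<^sup>+" by (cases y) (auto simp: x)
        also have "\<dots> \<longleftrightarrow> (prod.swap x, y) \<in> E\<^sup>+"
          using swap[of x "prod.swap y"] swap[of "prod.swap x" y] by auto
        finally show "y \<in> converse u \<longleftrightarrow> y \<in> E\<^sup>+ `` {prod.swap x}" by simp
      qed
      moreover have "prod.swap x \<in> A" using x by (auto simp: A_def)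
      ultimately show ?thesis unfolding M_def by (simp add: quotientI)
    qed
    fix u v w assume u: "u \<in> M" and v: "v \<in> M" and w: "w \<in> M"
    define f where "f = (\<lambda>(a, b). card (u `` {a} \<inter> converse v `` {b}))"
    have step: "f x = f y" if xy: "(x, y) \<in> E" for x y
    proof -
      obtain T t where T: "T \<in> F" "t \<in> T" "x \<in> t" "y \<in> t" using xy by (auto simp: E_def)
      obtain a b c d where eq: "x = (a, b)" "y = (c, d)" by (metis surj_pair)
      show ?thesis
        unfolding f_def eq prod.case
        by (rule regular_on_unions[OF F(1)[OF T(1)] MT[OF u T(1)] MT[OF v T(1)] T(2)])
          (use T(3,4) eq in simp_all)
    qed
    have const: "f x = f y" if "(x, y) \<in> E\<^sup>+" for x y
      using that by (induction rule: trancl_induct) (auto simp: step)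
    obtain x where "x \<in> A" "w = E\<^sup>+ `` {x}" using w by (auto simp: M_def quotient_def)
    then have "\<forall>y\<in>w. f y = f x" using const by auto
    then show "\<exists>c. \<forall>(\<alpha>, \<gamma>)\<in>w. card (u `` {\<alpha>} \<inter> converse v `` {\<gamma>}) = c"
      unfolding f_def by fast
  qed
  then show ?thesis using MT by (auto simp: F_def)
qed

lemma least_extension_unique:
  assumes "extends_at \<Omega> S \<alpha> T" "\<And>T'. extends_at \<Omega> S \<alpha> T' \<Longrightarrow> \<forall>u\<in>T. is_union T' u"
    and "extends_at \<Omega> S \<alpha> U" "\<And>T'. extends_at \<Omega> S \<alpha> T' \<Longrightarrow> \<forall>u\<in>U. is_union T' u"
  shows "T = U"
proof -
  have part: "partition_on (\<Omega> \<times> \<Omega>) T" "partition_on (\<Omega> \<times> \<Omega>) U"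
    using assms(1,3) by (auto simp: extends_at_def coherent_configuration_def)
  show ?thesis
    using partition_eq_if_mutual_unions[OF part assms(2)[OF assms(3)] assms(4)[OF assms(1)]]
      partition_eq_if_mutual_unions[OF part(2,1) assms(4)[OF assms(1)] assms(2)[OF assms(3)]]
    by (rule subset_antisym)
qed

lemma point_extension_unique:
  assumes "extends_at \<Omega> S \<alpha> T" "\<And>T'. extends_at \<Omega> S \<alpha> T' \<Longrightarrow> \<forall>u\<in>T. is_union T' u"
  shows "point_extension \<Omega> S \<alpha> = T"
  unfolding point_extension_def
proof (rule the_equality)
  show "extends_at \<Omega> S \<alpha> T \<and> (\<forall>T'. extends_at \<Omega> S \<alpha> T' \<longrightarrow> (\<forall>u\<in>T. is_union T' u))"
    using assms by simp
  fix U assume U: "extends_at \<Omega> S \<alpha> U \<and>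
    (\<forall>T'. extends_at \<Omega> S \<alpha> T' \<longrightarrow> (\<forall>u\<in>U. is_union T' u))"
  show "U = T"
    by (rule least_extension_unique[of \<Omega> S \<alpha>]) (use U assms in simp_all)
qed

lemma point_extension_least:
  assumes "coherent_configuration \<Omega> S" "\<alpha> \<in> \<Omega>"
  shows "extends_at \<Omega> S \<alpha> (point_extension \<Omega> S \<alpha>)"
    and "extends_at \<Omega> S \<alpha> T' \<Longrightarrow> u \<in> point_extension \<Omega> S \<alpha> \<Longrightarrow> is_union T' u"
proof -
  obtain T where "extends_at \<Omega> S \<alpha> T" "\<And>T'. extends_at \<Omega> S \<alpha> T' \<Longrightarrow> \<forall>u\<in>T. is_union T' u"
    using least_extension_exists[OF assms] by blast
  moreover from this have "point_extension \<Omega> S \<alpha> = T" by (rule point_extension_unique)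
  ultimately show "extends_at \<Omega> S \<alpha> (point_extension \<Omega> S \<alpha>)"
    and "extends_at \<Omega> S \<alpha> T' \<Longrightarrow> u \<in> point_extension \<Omega> S \<alpha> \<Longrightarrow> is_union T' u"
    by auto
qed

end

theory Submission
  imports Defs
begin

text \<open>
  It suffices to find a bijection \<open>f\<close> with \<open>f \<alpha> = \<alpha>'\<close> that induces \<open>\<phi>\<close>, since \<open>f\<close> then carries
  \<open>\<X>\<^sub>\<alpha>\<close> to \<open>\<X>'\<^bsub>\<alpha>'\<^esub>\<close>. Such an \<open>f\<close> must map \<open>\<alpha>u\<close> to \<open>\<alpha>'\<phi>(u)\<close>, which leaves one binary choice for each
  \<open>u \<in> S\<^sub>2\<close>. The choices for \<open>u\<close> and \<open>v\<close> constrain each other exactly when \<open>u\<^sup>*v\<close> has two elements,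
  and this happens whenever \<open>u\<^sup>\<bottom> \<noteq> v\<^sup>\<bottom>\<close>. Comparing the constraints
  in both schemes puts a sign on each edge of a graph that is essentially complete multipartite with
  parts indexed by \<open>S\<^sup>\<bottom>\<close>, and the choices can be made iff all cycles have trivial sign.

  A triangle with nontrivial sign has pairwise distinct \<open>u\<^sup>\<bottom>, v\<^sup>\<bottom>, w\<^sup>\<bottom>\<close>, each contained in the product
  of the other two. Either they are all thin and form a Klein group with \<open>1\<close>, or none of them is
  thin and \<open>u\<^sup>\<bottom>\<^sup>\<bottom>\<close> is. In both cases (using that the scheme is not Kleinian in the first one) there is
  a further element of \<open>S\<^sup>\<bottom>\<close>, and subdividing the triangle by a fourth vertex belonging to it gives three
  triangles with trivial sign. A 4-cycle without diagonals has two thin elements of \<open>S\<^sup>\<bottom>\<close> on its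
  vertices; since the scheme is not Kleinian there is again a third one to subdivide with.
\<close>

section \<open>Schemes: colours of pairs, intersection numbers and products\<close>

locale homogeneous_scheme =
  fixes \<Omega> :: "'a set" and S :: "'a rel set"
  assumes scheme: "scheme \<Omega> S"
begin

abbreviation product :: "'a rel \<Rightarrow> 'a rel \<Rightarrow> 'a rel set" where
  "product \<equiv> complex_product S"

text \<open>This is the colour of a pair of points. It turns computing a product into listing the
  colours of suitable pairs.\<close>

definition rel :: "'a \<Rightarrow> 'a \<Rightarrow> 'a rel" where
  "rel x y = (THE u. u \<in> S \<and> (x, y) \<in> u)"

lemma finite_points: "finite \<Omega>"
  and partition: "partition_on (\<Omega> \<times> \<Omega>) S"
  and Id_in: "Id_on \<Omega> \<in> S"
  and converse_in: "u \<in> S \<Longrightarrow> converse u \<in> S"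
  using scheme by (auto simp: scheme_def coherent_configuration_def)

lemma in_points: "u \<in> S \<Longrightarrow> (x, y) \<in> u \<Longrightarrow> x \<in> \<Omega> \<and> y \<in> \<Omega>"
  using partition by (auto simp: partition_on_def)

lemma rel_eqI: "u \<in> S \<Longrightarrow> (x, y) \<in> u \<Longrightarrow> rel x y = u"
  unfolding rel_def by (rule the_equality) (use partition_block_unique[OF partition] in blast)+

lemma rel_in: "x \<in> \<Omega> \<Longrightarrow> y \<in> \<Omega> \<Longrightarrow> rel x y \<in> S"
  and rel_mem: "x \<in> \<Omega> \<Longrightarrow> y \<in> \<Omega> \<Longrightarrow> (x, y) \<in> rel x y"
proof -
  assume "x \<in> \<Omega>" "y \<in> \<Omega>"
  then obtain u where "u \<in> S" "(x, y) \<in> u" using partition_onD1[OF partition] by blast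
  then show "rel x y \<in> S" "(x, y) \<in> rel x y" using rel_eqI by auto
qed

lemma rel_eq_iff: "x \<in> \<Omega> \<Longrightarrow> y \<in> \<Omega> \<Longrightarrow> u \<in> S \<Longrightarrow> rel x y = u \<longleftrightarrow> (x, y) \<in> u"
  using rel_eqI rel_mem by blast

lemma rel_converse: "x \<in> \<Omega> \<Longrightarrow> y \<in> \<Omega> \<Longrightarrow> rel y x = converse (rel x y)"
  by (rule rel_eqI) (auto simp: converse_in rel_in rel_mem)

lemma rel_refl: "x \<in> \<Omega> \<Longrightarrow> rel x x = Id_on \<Omega>"
  by (rule rel_eqI) (auto simp: Id_in)

lemma rel_eq_Id_iff: "x \<in> \<Omega> \<Longrightarrow> y \<in> \<Omega> \<Longrightarrow> rel x y = Id_on \<Omega> \<longleftrightarrow> x = y"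
  using rel_eq_iff[OF _ _ Id_in] by auto

lemma nonempty: "u \<in> S \<Longrightarrow> \<exists>x y. (x, y) \<in> u"
  using partition_onD3[OF partition] by (metis ex_in_conv surj_pair)

lemma regular:
  assumes "u \<in> S" "v \<in> S" "w \<in> S" "(x, y) \<in> w" "(x', y') \<in> w"
  shows "card (u `` {x} \<inter> converse v `` {y}) = card (u `` {x'} \<inter> converse v `` {y'})"
proof -
  have "\<exists>c. \<forall>(x, y)\<in>w. card (u `` {x} \<inter> converse v `` {y}) = c"
    using scheme assms(1-3) unfolding scheme_def coherent_configuration_def by blast
  then obtain c where "\<forall>(x, y)\<in>w. card (u `` {x} \<inter> converse v `` {y}) = c" ..
  from bspec[OF this assms(4)] bspec[OF this assms(5)] show ?thesis by simp
qed

lemma finite_neighbours: "u \<in> S \<Longrightarrow> finite (u `` {x})"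
  by (rule finite_subset[OF _ finite_points]) (use in_points in auto)

text \<open>The number of midpoints depends only on the colour of the pair of endpoints, so if it is
  nonzero for one pair it is nonzero for all pairs of that colour. This qualitative form of
  regularity lets a triangle be moved onto another edge of the same colour.\<close>

lemma path_transfer:
  assumes "u \<in> S" "v \<in> S" "w \<in> S" "(x, y) \<in> w" "(x', y') \<in> w" "(x, z) \<in> u" "(z, y) \<in> v"
  shows "\<exists>z'. (x', z') \<in> u \<and> (z', y') \<in> v"
proof -
  have "z \<in> u `` {x} \<inter> converse v `` {y}" using assms by auto
  then have "card (u `` {x} \<inter> converse v `` {y}) \<noteq> 0"
    using finite_neighbours[OF assms(1)] by (auto simp: card_eq_0_iff)
  then have "card (u `` {x'} \<inter> converse v `` {y'}) \<noteq> 0"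
    using regular[OF assms(1-5)] by simp
  then have "u `` {x'} \<inter> converse v `` {y'} \<noteq> {}" by fastforce
  then show ?thesis by auto
qed

lemma intersection_number_eq:
  assumes "u \<in> S" "v \<in> S" "w \<in> S" "(x, y) \<in> w"
  shows "intersection_number u v w = card (u `` {x} \<inter> converse v `` {y})"
  unfolding intersection_number_def
proof (rule the_equality)
  show "\<forall>(\<alpha>, \<gamma>)\<in>w. card (u `` {\<alpha>} \<inter> converse v `` {\<gamma>}) =
      card (u `` {x} \<inter> converse v `` {y})"
    using regular[OF assms(1-3) _ assms(4)] by blast
next
  fix c assume "\<forall>(\<alpha>, \<gamma>)\<in>w. card (u `` {\<alpha>} \<inter> converse v `` {\<gamma>}) = c"
  from bspec[OF this assms(4)] show "c = card (u `` {x} \<inter> converse v `` {y})" by simp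
qed

text \<open>Membership in a product asks for containment of a whole basic relation in
  \<open>u O v\<close>, but by \<open>path_transfer\<close> a single path is enough.\<close>

lemma productI:
  assumes "u \<in> S" "v \<in> S" "(x, z) \<in> u" "(z, y) \<in> v"
  shows "rel x y \<in> product u v"
proof -
  have xy: "x \<in> \<Omega>" "y \<in> \<Omega>" using assms in_points by blast+
  have "(x', y') \<in> u O v" if "(x', y') \<in> rel x y" for x' y'
    using path_transfer[OF assms(1,2) rel_in[OF xy] rel_mem[OF xy] that assms(3,4)] by blast
  then show ?thesis using rel_in[OF xy] by (auto simp: complex_product_def)
qed

lemma product_in: "w \<in> product u v \<Longrightarrow> w \<in> S"
  by (simp add: complex_product_def)

lemma product_path: "w \<in> product u v \<Longrightarrow> (x, y) \<in> w \<Longrightarrow> \<exists>z. (x, z) \<in> u \<and> (z, y) \<in> v"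
  by (auto simp: complex_product_def)

lemma product_iff_intersection_number:
  assumes "u \<in> S" "v \<in> S" "w \<in> S"
  shows "w \<in> product u v \<longleftrightarrow> intersection_number u v w \<noteq> 0"
proof -
  obtain x y where xy: "(x, y) \<in> w" using nonempty assms by blast
  have "intersection_number u v w \<noteq> 0 \<longleftrightarrow> u `` {x} \<inter> converse v `` {y} \<noteq> {}"
    unfolding intersection_number_eq[OF assms xy]
    using finite_neighbours[OF assms(1)] by (simp add: card_eq_0_iff)
  also have "\<dots> \<longleftrightarrow> w \<in> product u v"
  proof
    assume "u `` {x} \<inter> converse v `` {y} \<noteq> {}"
    then obtain z where "(x, z) \<in> u" "(z, y) \<in> v" by blast
    then show "w \<in> product u v" using productI[OF assms(1,2)] rel_eqI[OF assms(3) xy] by metis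
  next
    assume "w \<in> product u v"
    from product_path[OF this xy] show "u `` {x} \<inter> converse v `` {y} \<noteq> {}" by blast
  qed
  finally show ?thesis by simp
qed

text \<open>A triangle with colours \<open>u\<close>, \<open>v\<close>, \<open>w\<close> can be laid
  on any prescribed edge of colour \<open>u\<close>: seen from that edge, its third point is the
  midpoint of a path with colours \<open>w\<close> and \<open>converse v\<close>. So all colours of
  the product are visible from one pair.\<close>

lemma product_eq_right:
  assumes "u \<in> S" "v \<in> S" "(x, z) \<in> u"
  shows "product u v = rel x ` (v `` {z})"
proof (intro subset_antisym subsetI)
  fix w assume w: "w \<in> product u v"
  then obtain x0 y0 z0 where 0: "(x0, y0) \<in> w" "(x0, z0) \<in> u" "(z0, y0) \<in> v"
    using nonempty[OF product_in] product_path by metis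
  have "(y0, z0) \<in> converse v" using 0 by simp
  from path_transfer[OF product_in[OF w] converse_in[OF assms(2)] assms(1) 0(2) assms(3) 0(1) this]
  obtain y where "(x, y) \<in> w" "(z, y) \<in> v" by auto
  then show "w \<in> rel x ` (v `` {z})" using rel_eqI[OF product_in[OF w]] by force
qed (use productI[OF assms(1,2)] assms(3) in auto)

lemma product_eq_left:
  assumes "u \<in> S" "v \<in> S" "(z, y) \<in> v"
  shows "product u v = (\<lambda>x. rel x y) ` (converse u `` {z})"
proof (intro subset_antisym subsetI)
  fix w assume w: "w \<in> product u v"
  then obtain x0 y0 z0 where 0: "(x0, y0) \<in> w" "(x0, z0) \<in> u" "(z0, y0) \<in> v"
    using nonempty[OF product_in] product_path by metis
  have "(z0, x0) \<in> converse u" using 0 by simp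
  from path_transfer[OF converse_in[OF assms(1)] product_in[OF w] assms(2) 0(3) assms(3) this 0(1)]
  obtain x where "(x, y) \<in> w" "(x, z) \<in> u" by auto
  then show "w \<in> (\<lambda>x. rel x y) ` (converse u `` {z})" using rel_eqI[OF product_in[OF w]] by force
qed (use productI[OF assms(1,2)] assms(3) in auto)

lemma valency_eq_intersection_number:
  assumes "u \<in> S" "x \<in> \<Omega>"
  shows "card (u `` {x}) = intersection_number u (converse u) (Id_on \<Omega>)"
proof -
  have "(x, x) \<in> Id_on \<Omega>" using assms by auto
  from intersection_number_eq[OF assms(1) converse_in[OF assms(1)] Id_in this]
  show ?thesis by simp
qed

lemma neighbours_nonempty:
  assumes "u \<in> S" "x \<in> \<Omega>"
  shows "\<exists>y. (x, y) \<in> u"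
proof -
  obtain x0 y0 where 0: "(x0, y0) \<in> u" using nonempty assms by blast
  then have "(x0, x0) \<in> Id_on \<Omega>" "(x, x) \<in> Id_on \<Omega>" using assms in_points by auto
  from path_transfer[OF assms(1) converse_in[OF assms(1)] Id_in this 0] 0
  show ?thesis by auto
qed

text \<open>Double counting: a basic relation has \<open>card \<Omega>\<close> times its valency
  many pairs, and transposition preserves the number of pairs.\<close>

lemma valency_converse:
  assumes "u \<in> S" "x \<in> \<Omega>" "y \<in> \<Omega>"
  shows "card (converse u `` {y}) = card (u `` {x})"
proof -
  have *: "card v = card \<Omega> * card (v `` {z})" if "v \<in> S" "z \<in> \<Omega>" for v z
  proof -
    have "v = Sigma \<Omega> (\<lambda>a. v `` {a})" using in_points[OF that(1)] by auto
    then have "card v = (\<Sum>a\<in>\<Omega>. card (v `` {a}))"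
      using finite_points finite_neighbours[OF that(1)] by (metis card_SigmaI)
    also have "\<dots> = (\<Sum>a\<in>\<Omega>. card (v `` {z}))"
      by (rule sum.cong) (use that valency_eq_intersection_number in auto)
    finally show ?thesis by simp
  qed
  have "card (converse u) = card u" by (rule card_inverse)
  then have eq: "card \<Omega> * card (converse u `` {y}) = card \<Omega> * card (u `` {x})"
    using *[OF assms(1,2)] *[OF converse_in[OF assms(1)] assms(3)] by metis
  have "card \<Omega> \<noteq> 0" using finite_points assms(2) by auto
  then show ?thesis using eq by simp
qed

lemma valency_partI:
  assumes "u \<in> S" "x \<in> \<Omega>" "card (u `` {x}) = m"
  shows "u \<in> valency_part \<Omega> S m"
  using assms valency_eq_intersection_number unfolding valency_part_def by auto

lemma valency_partD: "u \<in> valency_part \<Omega> S m \<Longrightarrow> x \<in> \<Omega> \<Longrightarrow> card (u `` {x}) = m"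
  by (simp add: valency_part_def)

lemma valency_part_in: "u \<in> valency_part \<Omega> S m \<Longrightarrow> u \<in> S"
  by (simp add: valency_part_def)

lemma converse_valency_part: "u \<in> valency_part \<Omega> S m \<Longrightarrow> converse u \<in> valency_part \<Omega> S m"
  using valency_converse converse_in by (fastforce simp: valency_part_def)

section \<open>Thin relations and the identity\<close>

abbreviation "thin \<equiv> valency_part \<Omega> S 1"

lemma thin_unique:
  assumes "u \<in> thin" "(x, y) \<in> u" "(x, z) \<in> u"
  shows "y = z"
proof -
  have "card (u `` {x}) = 1" using assms valency_partD valency_part_in in_points by meson
  then obtain a where "u `` {x} = {a}" by (auto simp: card_1_singleton_iff)
  moreover have "y \<in> u `` {x}" "z \<in> u `` {x}" using assms by auto
  ultimately show ?thesis by simp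
qed

lemma thin_product_left:
  assumes "u \<in> thin" "v \<in> S"
  shows "\<exists>w. product u v = {w}"
proof -
  obtain z y where zy: "(z, y) \<in> v" using nonempty assms by blast
  then have "card (converse u `` {z}) = 1"
    using valency_partD[OF converse_valency_part[OF assms(1)]] in_points assms by blast
  then show ?thesis
    unfolding product_eq_left[OF valency_part_in[OF assms(1)] assms(2) zy]
    by (auto simp: card_1_singleton_iff)
qed

lemma thin_product_right:
  assumes "u \<in> S" "v \<in> thin"
  shows "\<exists>w. product u v = {w}"
proof -
  obtain x z where xz: "(x, z) \<in> u" using nonempty assms by blast
  then have "card (v `` {z}) = 1" using valency_partD[OF assms(2)] in_points assms by blast
  then show ?thesis
    unfolding product_eq_right[OF assms(1) valency_part_in[OF assms(2)] xz]
    by (auto simp: card_1_singleton_iff)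
qed

text \<open>The product has a single element, and every path of \<open>u O v\<close> lands in it;
  hence the relational product is itself a basic relation.\<close>

lemma thin_comp:
  assumes "u \<in> thin" "v \<in> S"
  shows "u O v \<in> S" and "product u v = {u O v}"
proof -
  obtain w where w: "product u v = {w}" using thin_product_left[OF assms] by blast
  then have sub: "w \<subseteq> u O v" and wS: "w \<in> S" by (auto simp: complex_product_def)
  have "u O v \<subseteq> w"
  proof
    fix p assume "p \<in> u O v"
    then obtain x z y where p: "p = (x, y)" "(x, z) \<in> u" "(z, y) \<in> v" by blast
    have "rel x y \<in> {w}" using productI[OF valency_part_in[OF assms(1)] assms(2) p(2,3)] w by simp
    moreover have "x \<in> \<Omega>" "y \<in> \<Omega>" using p assms in_points valency_part_in by blast+
    ultimately show "p \<in> w" using rel_mem p by auto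
  qed
  then have "w = u O v" using sub by blast
  then show "u O v \<in> S" "product u v = {u O v}" using w wS by auto
qed

lemma thin_comp_valency:
  assumes "u \<in> thin" "v \<in> valency_part \<Omega> S m"
  shows "u O v \<in> valency_part \<Omega> S m"
proof -
  obtain x y where xy: "(x, y) \<in> u" using nonempty valency_part_in assms by blast
  have pts: "x \<in> \<Omega>" "y \<in> \<Omega>" using in_points valency_part_in[OF assms(1)] xy by auto
  have "(u O v) `` {x} = v `` {y}" using xy thin_unique[OF assms(1)] by blast
  then show ?thesis
    using valency_partI[OF thin_comp(1) pts(1)] valency_partD[OF assms(2) pts(2)]
      assms(1) valency_part_in[OF assms(2)] by simp
qed

lemma Id_thin: "Id_on \<Omega> \<in> thin"
proof -
  have "Id_on \<Omega> `` {x} = {x}" if "x \<in> \<Omega>" for x using that by auto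
  then show ?thesis using Id_in by (simp add: valency_part_def)
qed

lemma Id_comp: "u \<in> S \<Longrightarrow> Id_on \<Omega> O u = u" and comp_Id: "u \<in> S \<Longrightarrow> u O Id_on \<Omega> = u"
  using in_points by fast+

lemma product_Id_left: "u \<in> S \<Longrightarrow> product (Id_on \<Omega>) u = {u}"
  using thin_comp(2)[OF Id_thin] Id_comp by simp

lemma product_Id_right:
  assumes "u \<in> S"
  shows "product u (Id_on \<Omega>) = {u}"
proof -
  obtain x z where xz: "(x, z) \<in> u" using nonempty assms by blast
  have "Id_on \<Omega> `` {z} = {z}" using in_points[OF assms xz] by auto
  then show ?thesis using product_eq_right[OF assms Id_in xz] rel_eqI[OF assms xz] by simp
qed

text \<open>This expresses transposition through products, which is how algebraic isomorphisms are
  seen to commute with it.\<close>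

lemma product_converse_iff_Id:
  assumes "u \<in> S" "v \<in> S"
  shows "Id_on \<Omega> \<in> product u v \<longleftrightarrow> v = converse u"
proof
  assume Id: "Id_on \<Omega> \<in> product u v"
  obtain x where "(x, x) \<in> Id_on \<Omega>" using nonempty[OF Id_in] by blast
  from product_path[OF Id this] obtain z where "(x, z) \<in> u" "(z, x) \<in> v" by blast
  then show "v = converse u"
    using partition_block_unique[OF partition assms(2) converse_in[OF assms(1)], of "(z, x)"] by blast
next
  assume v: "v = converse u"
  obtain x z where xz: "(x, z) \<in> u" using nonempty assms by blast
  then have "rel x x \<in> product u v" using productI[OF assms xz, of x] v by blast
  then show "Id_on \<Omega> \<in> product u v" using rel_refl in_points[OF assms(1) xz] by simp
qed

end


section \<open>Quasi-thin schemes: thick relations and their neighbourhoods of two points\<close>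

locale quasi_thin_scheme = homogeneous_scheme +
  assumes quasi_thin: "quasi_thin \<Omega> S"
begin

abbreviation "thick \<equiv> valency_part \<Omega> S 2"

lemma thin_or_thick: "u \<in> S \<Longrightarrow> u \<in> thin \<or> u \<in> thick"
proof -
  assume u: "u \<in> S"
  then obtain x y where "(x, y) \<in> u" using nonempty by blast
  then have x: "x \<in> \<Omega>" using in_points u by blast
  then have "card (u `` {x}) = 1 \<or> card (u `` {x}) = 2" using quasi_thin u by (auto simp: quasi_thin_def)
  then show ?thesis using valency_partI[OF u x] by blast
qed

lemma thick_other:
  assumes "u \<in> thick" "(x, y) \<in> u"
  obtains z where "(x, z) \<in> u" "z \<noteq> y" "u `` {x} = {y, z}"
proof -
  have "card (u `` {x}) = 2" using assms valency_partD valency_part_in in_points by meson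
  then obtain a b where ab: "u `` {x} = {a, b}" "a \<noteq> b" by (auto simp: card_2_iff)
  moreover have "y \<in> u `` {x}" using assms by auto
  ultimately have "u `` {x} = {y, if y = a then b else a}" "(if y = a then b else a) \<noteq> y" by auto
  then show thesis using that by blast
qed

lemma thin_not_thick:
  assumes "u \<in> thin"
  shows "u \<notin> thick"
proof
  assume "u \<in> thick"
  obtain x y where xy: "(x, y) \<in> u" using nonempty[OF valency_part_in[OF assms]] by blast
  obtain z where "(x, z) \<in> u" "z \<noteq> y" using thick_other[OF \<open>u \<in> thick\<close> xy] by blast
  then show False using thin_unique[OF assms xy] by blast
qed

lemma thick_cases:
  assumes "u \<in> thick" "(x, y) \<in> u" "(x, z) \<in> u" "y \<noteq> z"
  shows "u `` {x} = {y, z}"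
proof -
  obtain t where "u `` {x} = {y, t}" using thick_other[OF assms(1,2)] by blast
  moreover have "z \<in> u `` {x}" using assms by simp
  ultimately show ?thesis using assms(4) by auto
qed

lemma thick_two:
  assumes "u \<in> thick" "(x, y) \<in> u" "(x, z) \<in> u" "y \<noteq> z" "(x, t) \<in> u"
  shows "t = y \<or> t = z"
proof -
  have "t \<in> u `` {x}" using assms by simp
  then show ?thesis using thick_cases[OF assms(1-4)] by simp
qed

lemma thick_two':
  "u \<in> thick \<Longrightarrow> (y, x) \<in> u \<Longrightarrow> (z, x) \<in> u \<Longrightarrow> y \<noteq> z \<Longrightarrow> (t, x) \<in> u \<Longrightarrow> t = y \<or> t = z"
  using thick_two[OF converse_valency_part] by blast

lemma product_thick:
  assumes "u \<in> thick" "v \<in> thick" "(x, y) \<in> u" "(x, z) \<in> v" "(x, z') \<in> v" "z \<noteq> z'"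
  shows "product (converse u) v = {rel y z, rel y z'}"
proof -
  have "product (converse u) v = rel y ` (v `` {x})"
    using assms by (intro product_eq_right) (auto simp: converse_in valency_part_in)
  then show ?thesis using thick_cases[OF assms(2,4-6)] by simp
qed

lemma product_card:
  assumes "u \<in> S" "v \<in> S"
  shows "card (product u v) = 1 \<or> card (product u v) = 2 \<and> u \<in> thick \<and> v \<in> thick"
proof (cases "u \<in> thin \<or> v \<in> thin")
  case True
  then show ?thesis using thin_product_left[OF _ assms(2)] thin_product_right[OF assms(1)] by (auto simp: card_1_singleton_iff)
next
  case False
  then have uv: "u \<in> thick" "v \<in> thick" using thin_or_thick assms by auto
  obtain z x where zx: "(z, x) \<in> u" using nonempty assms by blast
  then have x: "x \<in> \<Omega>" using in_points assms by blast
  obtain y where y: "(x, y) \<in> v" using neighbours_nonempty assms x by blast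
  obtain y' where "(x, y') \<in> v" "y' \<noteq> y" using thick_other[OF uv(2) y] by blast
  then have "product u v = {rel z y, rel z y'}"
    using product_thick[OF converse_valency_part[OF uv(1)] uv(2) _ y, of z y'] zx by auto
  then show ?thesis using uv by (auto simp: card_insert_if)
qed

section \<open>The relation u^perp and products of two thick relations\<close>

lemma perp_unique:
  assumes u: "u \<in> thick"
  shows "\<exists>!v. v \<in> S \<and> product u (converse u) = {Id_on \<Omega>, v}"
proof -
  have uS: "u \<in> S" using u valency_part_in by blast
  obtain x z where xz: "(x, z) \<in> u" using nonempty uS by blast
  then have x: "x \<in> \<Omega>" using in_points uS by blast
  \<comment> \<open>Transposition preserves valency, so \<open>x\<close> and \<open>y\<close> are
    all the \<open>u\<close>-predecessors of \<open>z\<close>, and the product consists of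
    \<open>rel x x\<close> and \<open>rel x y\<close>.\<close>
  obtain y where y: "(z, y) \<in> converse u" "y \<noteq> x"
    using thick_other[OF converse_valency_part[OF u], of z x] xz by blast
  then have yO: "y \<in> \<Omega>" using in_points[OF uS] by blast
  have "product u (converse u) = {rel x x, rel x y}"
    using product_thick[OF converse_valency_part[OF u] converse_valency_part[OF u], of z x x y] xz y
    by simp
  then have *: "product u (converse u) = {Id_on \<Omega>, rel x y}" using rel_refl x by simp
  have "v = rel x y" if "product u (converse u) = {Id_on \<Omega>, v}" for v
    using that * rel_eq_Id_iff[OF x yO] y(2) by (auto simp: doubleton_eq_iff)
  then show ?thesis using * rel_in[OF x yO] by blast
qed

abbreviation orth :: "'a rel \<Rightarrow> 'a rel" where "orth u \<equiv> perp \<Omega> S u"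

lemma orth_in: "u \<in> thick \<Longrightarrow> orth u \<in> S"
  and product_converse: "u \<in> thick \<Longrightarrow> product u (converse u) = {Id_on \<Omega>, orth u}"
  using theI'[OF perp_unique] unfolding perp_def by blast+

text \<open>Together with \<open>orth_common\<close> this describes \<open>orth u\<close> as a graph
  whose edges are the pairs of distinct points with a common \<open>u\<close>-neighbour. The later
  arguments mostly work with this picture.\<close>

lemma orth_eqI:
  assumes "u \<in> thick" "(x, z) \<in> u" "(y, z) \<in> u" "x \<noteq> y"
  shows "rel x y = orth u" and "(x, y) \<in> orth u"
proof -
  have uS: "u \<in> S" using assms valency_part_in by blast
  have xy: "x \<in> \<Omega>" "y \<in> \<Omega>" using assms in_points[OF uS] by blast+
  have "rel x y \<in> product u (converse u)"
    using productI[OF uS converse_in[OF uS] assms(2)] assms(3) by blast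
  then show "rel x y = orth u" using product_converse[OF assms(1)] rel_eq_Id_iff[OF xy] assms(4) by auto
  then show "(x, y) \<in> orth u" using rel_mem[OF xy] by simp
qed

lemma orth_common:
  assumes "u \<in> thick" "(x, y) \<in> orth u"
  shows "\<exists>z. (x, z) \<in> u \<and> (y, z) \<in> u"
  using product_path[OF _ assms(2), of u "converse u"] product_converse[OF assms(1)] by auto

lemma orth_not_Id: "u \<in> thick \<Longrightarrow> orth u \<noteq> Id_on \<Omega>"
proof
  assume u: "u \<in> thick" and Id: "orth u = Id_on \<Omega>"
  have uS: "u \<in> S" using u valency_part_in by blast
  obtain x z where xz: "(x, z) \<in> u" using nonempty uS by blast
  obtain y where y: "(y, z) \<in> u" "y \<noteq> x"
    using thick_other[OF converse_valency_part[OF u], of z x] xz by blast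
  then have "(x, y) \<in> orth u" using orth_eqI(2)[OF u xz] by blast
  then show False using Id y by auto
qed

lemma orth_irrefl: "u \<in> thick \<Longrightarrow> (x, y) \<in> orth u \<Longrightarrow> x \<noteq> y"
  using orth_not_Id rel_eqI[OF orth_in] rel_refl in_points[OF orth_in] by metis

lemma orth_sym: "u \<in> thick \<Longrightarrow> (x, y) \<in> orth u \<Longrightarrow> (y, x) \<in> orth u"
  using orth_common orth_eqI(2) orth_irrefl by metis

lemma orth_converse: "u \<in> thick \<Longrightarrow> converse (orth u) = orth u"
  using orth_sym by auto

text \<open>Suppose \<open>z\<close> and \<open>z'\<close> were different. A second
  \<open>orth u\<close>-neighbour \<open>y'\<close> of \<open>x\<close> shares one of them with
  \<open>x\<close>, and that point then has the three \<open>u\<close>-predecessors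
  \<open>x\<close>, \<open>y\<close> and \<open>y'\<close>.\<close>

lemma thick_orth_share:
  assumes u: "u \<in> thick" and o: "orth u \<in> thick"
    and "(x, y) \<in> orth u" "(x, z) \<in> u" "(y, z) \<in> u" "(x, z') \<in> u" "(y, z') \<in> u"
  shows "z = z'"
proof (rule ccontr)
  assume "z \<noteq> z'"
  obtain y' where y': "(x, y') \<in> orth u" "y' \<noteq> y" using thick_other[OF o assms(3)] by blast
  obtain t where t: "(x, t) \<in> u" "(y', t) \<in> u" using orth_common[OF u y'(1)] by blast
  have "t = z \<or> t = z'" using thick_two[OF u assms(4,6) \<open>z \<noteq> z'\<close> t(1)] .
  then have yt: "(y, t) \<in> u" using assms by blast
  have "y' = x \<or> y' = y" using thick_two'[OF u t(1) yt orth_irrefl[OF u assms(3)] t(2)] .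
  then show False using y' orth_irrefl[OF u y'(1)] by blast
qed

text \<open>Let \<open>x\<close> and \<open>y\<close> be the two \<open>u\<close>-predecessors of
  \<open>b\<close>. The only colour \<open>w\<close> in the product joins \<open>b\<close> to all
  \<open>v\<close>-neighbours of both, and \<open>b\<close> has just two
  \<open>w\<close>-neighbours. So \<open>x\<close> and \<open>y\<close> have the same two
  \<open>v\<close>-neighbours: they are related by \<open>orth v\<close> as well as by
  \<open>orth u\<close>, and \<open>thick_orth_share\<close> rules out that this relation is
  thick.\<close>

lemma single_product_orth:
  assumes u: "u \<in> thick" and v: "v \<in> thick" and c: "card (product (converse u) v) = 1"
  shows "orth u = orth v" and "orth u \<in> thin"
proof -
  have S: "u \<in> S" "v \<in> S" using u v valency_part_in by blast+
  obtain x b where xb: "(x, b) \<in> u" using nonempty S by blast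
  then have bx: "(b, x) \<in> converse u" by simp
  have pts: "x \<in> \<Omega>" "b \<in> \<Omega>" using in_points[OF S(1) xb] by auto
  obtain d where d: "(x, d) \<in> v" using neighbours_nonempty[OF S(2) pts(1)] by blast
  obtain d' where d': "(x, d') \<in> v" "d' \<noteq> d" "v `` {x} = {d, d'}" using thick_other[OF v d] by blast
  obtain y where y: "(y, b) \<in> u" "y \<noteq> x" using thick_other[OF converse_valency_part[OF u] bx] by blast
  have yO: "y \<in> \<Omega>" using in_points[OF S(1) y(1)] by auto
  obtain w where w: "product (converse u) v = {w}" using c by (auto simp: card_1_singleton_iff)
  have wS: "w \<in> S" using product_in w by blast
  have in_w: "(b, e) \<in> w" if "(z, e) \<in> v" "(z, b) \<in> u" for z e
  proof -
    have "rel b e = w" using productI[OF converse_in[OF S(1)] S(2) _ that(1)] that(2) w by blast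
    then show ?thesis using rel_mem in_points[OF S(1) that(2)] in_points[OF S(2) that(1)] by blast
  qed
  have "w \<in> thick"
    using thin_or_thick[OF wS] thin_unique in_w[OF d xb] in_w[OF d'(1) xb] d'(2) by blast
  then have y_sub: "e = d \<or> e = d'" if "(y, e) \<in> v" for e
    using thick_two[OF _ in_w[OF d xb] in_w[OF d'(1) xb] d'(2)[symmetric] in_w[OF that y(1)]] by blast
  obtain e where e: "(y, e) \<in> v" using neighbours_nonempty[OF S(2) yO] by blast
  obtain e' where "(y, e') \<in> v" "e' \<noteq> e" using thick_other[OF v e] by blast
  then have yd: "(y, d) \<in> v" "(y, d') \<in> v" using y_sub e by blast+
  have ov: "(x, y) \<in> orth v" using orth_eqI(2)[OF v d yd(1)] y by blast
  then show eq: "orth u = orth v"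
    using orth_eqI[OF u xb y(1)] y(2) rel_eqI[OF orth_in[OF v] ov] by simp
  show "orth u \<in> thin"
    using thick_orth_share[OF v _ ov d yd(1) d'(1) yd(2)] d'(2) thin_or_thick[OF orth_in[OF v]] eq by auto
qed

text \<open>Two points \<open>x\<close>, \<open>y\<close> related by the common perp have a common
  \<open>u\<close>-neighbour \<open>b\<close> and a common \<open>v\<close>-neighbour
  \<open>d\<close>, and \<open>rel b d\<close> is the thin relation. Were it thick, a second point
  \<open>e\<close> of that colour from \<open>b\<close> would be, together with \<open>d\<close>,
  the \<open>v\<close>-neighbourhood of \<open>x\<close> or of \<open>y\<close>, and the product
  would have one element only.\<close>

lemma linked_orth_thin:
  assumes u: "u \<in> thick" and v: "v \<in> thick" and eq: "orth u = orth v"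
    and c: "card (product (converse u) v) = 2"
  shows "\<exists>a\<in>product (converse u) v. a \<in> thin"
proof -
  have S: "u \<in> S" "v \<in> S" using u v valency_part_in by blast+
  obtain x y where xy: "(x, y) \<in> orth u" using nonempty[OF orth_in[OF u]] by blast
  obtain b where b: "(x, b) \<in> u" "(y, b) \<in> u" using orth_common[OF u xy] by blast
  obtain d where d: "(x, d) \<in> v" "(y, d) \<in> v" using orth_common[OF v] xy eq by metis
  have pts: "b \<in> \<Omega>" "d \<in> \<Omega>" using in_points[OF S(1) b(1)] in_points[OF S(2) d(1)] by auto
  let ?a = "rel b d"
  have aP: "?a \<in> product (converse u) v" using productI[OF converse_in[OF S(1)] S(2), of b x d] b d by blast
  have False if thick: "?a \<in> thick"
  proof -
    have aS: "?a \<in> S" "(b, d) \<in> ?a" using rel_in rel_mem pts by auto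
    obtain e where e: "(b, e) \<in> ?a" "e \<noteq> d" using thick_other[OF thick aS(2)] by blast
    obtain z where z: "(b, z) \<in> converse u" "(z, e) \<in> v"
      using path_transfer[OF converse_in[OF S(1)] S(2) aS(1,2) e(1), of x] b d by blast
    have "z = x \<or> z = y" using thick_two'[OF u b orth_irrefl[OF u xy]] z(1) by blast
    then have zd: "(z, d) \<in> v" using z d by blast
    have "product (converse u) v = {rel b d, rel b e}"
      using product_thick[OF u v _ zd z(2)] z(1) e(2) by auto
    then show False using c rel_eqI[OF aS(1) e(1)] by simp
  qed
  then show ?thesis using thin_or_thick[OF rel_in[OF pts]] aP by blast
qed

text \<open>Adjacency in the constraint graph. With two colours available between a
  \<open>u\<close>-neighbour and a \<open>v\<close>-neighbour of a point, prescribing the colour is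
  a genuine condition.\<close>

definition linked :: "'a rel \<Rightarrow> 'a rel \<Rightarrow> bool" where
  "linked u v \<longleftrightarrow> u \<in> S \<and> v \<in> S \<and> card (product (converse u) v) = 2"

lemma linked_thick: "linked u v \<Longrightarrow> u \<in> thick \<and> v \<in> thick"
  using product_card[OF converse_in] converse_valency_part[of "converse u" 2]
  by (fastforce simp: linked_def)

lemma not_linked: "u \<in> S \<Longrightarrow> v \<in> S \<Longrightarrow> \<not> linked u v \<Longrightarrow> card (product (converse u) v) = 1"
  using product_card[OF converse_in] by (auto simp: linked_def)

text \<open>Transposition maps \<open>product (converse u) v\<close> bijectively onto
  \<open>product (converse v) u\<close>.\<close>

lemma linked_sym: "linked u v \<Longrightarrow> linked v u"
proof -
  assume l: "linked u v"
  then have S: "u \<in> S" "v \<in> S" by (auto simp: linked_def)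
  obtain x b where xb: "(x, b) \<in> u" using nonempty S by blast
  then have pts: "x \<in> \<Omega>" "b \<in> \<Omega>" using in_points S by blast+
  have "product (converse v) u = (\<lambda>y. rel y b) ` (v `` {x})"
    using product_eq_left[OF converse_in[OF S(2)] S(1) xb] by simp
  also have "\<dots> = converse ` (rel b ` (v `` {x}))"
    unfolding image_image by (rule image_cong[OF refl]) (use rel_converse[OF pts(2)] in_points[OF S(2)] in blast)
  also have "rel b ` (v `` {x}) = product (converse u) v"
    using product_eq_right[OF converse_in[OF S(1)] S(2), of b x] xb by simp
  finally have "card (product (converse v) u) = card (product (converse u) v)"
    by (simp add: card_image inj_on_def)
  then show ?thesis using l S by (simp add: linked_def)
qed

lemma linked_two:
  assumes l: "linked u v" and "(x, b) \<in> u" "(x, b') \<in> u" "b \<noteq> b'" "(x, c) \<in> v"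
  shows "product (converse u) v = {rel b c, rel b' c}" and "rel b c \<noteq> rel b' c"
proof -
  have S: "u \<in> S" "v \<in> S" and u: "u \<in> thick" using l linked_thick by (auto simp: linked_def)
  show eq: "product (converse u) v = {rel b c, rel b' c}"
    using product_eq_left[OF converse_in[OF S(1)] S(2) assms(5)] thick_cases[OF u assms(2-4)] by simp
  show "rel b c \<noteq> rel b' c" using l eq by (auto simp: linked_def)
qed

lemma linked_if_orth_neq: "u \<in> thick \<Longrightarrow> v \<in> thick \<Longrightarrow> orth u \<noteq> orth v \<Longrightarrow> linked u v"
  using single_product_orth not_linked valency_part_in by blast

text \<open>A path with colours \<open>orth v\<close>, \<open>w\<close> between points related by
  \<open>w\<close> starts with two distinct points that have a common \<open>w\<close>-neighbour, so
  its first edge would also have colour \<open>orth w\<close>.\<close>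

lemma orth_notin_product:
  assumes v: "v \<in> thick" and w: "w \<in> thick" and "orth v \<noteq> orth w"
  shows "w \<notin> product (orth v) w"
proof
  assume *: "w \<in> product (orth v) w"
  obtain x z where xz: "(x, z) \<in> w" using nonempty valency_part_in w by blast
  then obtain y where y: "(x, y) \<in> orth v" "(y, z) \<in> w" using product_path[OF *] by blast
  then have "(x, y) \<in> orth w" using orth_eqI(2)[OF w xz] orth_irrefl[OF v] by blast
  then show False using partition_block_unique[OF partition orth_in orth_in] v w y(1) assms(3) by blast
qed

section \<open>Thin elements of S^perp and a criterion for being Kleinian\<close>

lemma orth_involution:
  assumes "u \<in> thick" "orth u \<in> thin"
  shows "orth u O orth u = Id_on \<Omega>"
proof -
  have "product (orth u) (orth u) = {orth u O orth u}"
    using thin_comp(2)[OF assms(2) orth_in[OF assms(1)]] .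
  moreover have "Id_on \<Omega> \<in> product (orth u) (orth u)"
    using product_converse_iff_Id[OF orth_in orth_in] orth_converse assms(1) by simp
  ultimately show ?thesis by simp
qed

text \<open>Translation by a thin relation carries common neighbours along. It is used in
  \<open>kleinianI\<close> to place a conjugate inside S^perp.\<close>

lemma orth_conjugate:
  assumes s: "s \<in> thin" and u: "u \<in> thick" and o: "orth u \<in> thin"
  shows "orth (s O u) = s O orth u O converse s" and "s O u \<in> thick"
proof -
  show su: "s O u \<in> thick" using thin_comp_valency[OF s u] .
  have "s O orth u O converse s \<in> S"
    using thin_comp(1)[OF s] thin_comp_valency[OF o converse_valency_part[OF s]] valency_part_in by blast
  moreover obtain x y where xy: "(x, y) \<in> s O orth u O converse s" using nonempty calculation by blast
  then obtain x' y' where 1: "(x, x') \<in> s" "(x', y') \<in> orth u" "(y, y') \<in> s" by blast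
  then obtain z where "(x', z) \<in> u" "(y', z) \<in> u" using orth_common[OF u] by blast
  then have "(x, z) \<in> s O u" "(y, z) \<in> s O u" using 1 by auto
  moreover have "x \<noteq> y" using 1 orth_irrefl[OF u] thin_unique[OF s] by blast
  ultimately show "orth (s O u) = s O orth u O converse s"
    using orth_eqI(2)[OF su] partition_block_unique[OF partition orth_in[OF su] _ _ xy] by blast
qed

text \<open>The point is that \<open>p\<close> and \<open>q\<close> commute. The conjugate
  \<open>p O q O p\<close> is again in S^perp, hence one of \<open>p\<close>, \<open>q\<close>,
  \<open>p O q\<close>. Being \<open>p\<close> would give \<open>q = p\<close>, and being
  \<open>p O q\<close> would give that \<open>p\<close> is the identity, so it is \<open>q\<close>.
  This yields the multiplication table of the four relations. They form a closed set containing
  every \<open>product x (converse x)\<close>, and any such closed set contains \<open>p\<close>,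
  \<open>q\<close> and their product. The inclusion covers both the case where \<open>p O q\<close>
  lies in S^perp and the case where it does not.\<close>

lemma kleinianI:
  assumes p: "p \<in> perp_set \<Omega> S" "p \<in> thin" and q: "q \<in> perp_set \<Omega> S" "q \<in> thin" and "p \<noteq> q"
    and sub: "perp_set \<Omega> S \<subseteq> {p, q, p O q}"
  shows "kleinian \<Omega> S"
proof -
  define e where "e = Id_on \<Omega>"
  define r where "r = p O q"
  obtain u where u: "u \<in> thick" "p = orth u" using p by (auto simp: perp_set_def)
  obtain v where v: "v \<in> thick" "q = orth v" using q by (auto simp: perp_set_def)
  have S: "p \<in> S" "q \<in> S" "r \<in> S" "r \<in> thin"
    using p q valency_part_in thin_comp_valency[OF p(2) q(2)] by (auto simp: r_def)
  have e: "e \<in> S" "e \<in> thin" using Id_in Id_thin by (auto simp: e_def)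
  have sym: "converse p = p" "converse q = q" "converse e = e"
    using orth_converse u v by (auto simp: e_def)
  have pp: "p O p = e" and qq: "q O q = e"
    using orth_involution u v p q by (auto simp: e_def)
  have e_left: "e O x = x" and e_right: "x O e = x" if "x \<in> S" for x
    using Id_comp comp_Id that by (auto simp: e_def)
  have pe: "p \<noteq> e" and qe: "q \<noteq> e" using orth_not_Id u v by (auto simp: e_def)
  have "orth (p O v) = p O q O p" "p O v \<in> thick"
    using orth_conjugate[OF p(2) v(1)] q(2) v(2) sym by simp_all
  then have "p O q O p \<in> perp_set \<Omega> S" unfolding perp_set_def by (metis imageI)
  then have "p O q O p \<in> {p, q, r}" using sub unfolding r_def by (rule set_mp[rotated])
  moreover have "p O q O p \<noteq> p"
  proof
    assume "p O q O p = p"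
    then have "p O (p O q O p) O p = p O p O p" by simp
    then have "(p O p) O q O (p O p) = p O (p O p)" by (simp add: O_assoc)
    then show False using \<open>p \<noteq> q\<close> S e_left e_right by (simp add: pp)
  qed
  moreover have "p O q O p \<noteq> r"
  proof
    assume "p O q O p = r"
    then have "q O p O (p O q O p) = q O p O (p O q)" by (simp add: r_def)
    then have "q O (p O p) O q O p = q O (p O p) O q" by (simp add: O_assoc)
    then show False using pe S e_left e_right by (simp add: pp qq flip: O_assoc)
  qed
  ultimately have pqp: "p O q O p = q" by simp
  have "q O p = p O p O q O p" using S e_left by (simp add: pp flip: O_assoc)
  then have qp: "q O p = r" using pqp by (simp add: r_def)
  have pq: "p O q = r" by (simp add: r_def)
  have pr: "p O r = q" using pqp qp by simp
  have rp: "r O p = q" using pqp by (simp add: r_def O_assoc)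
  have rq: "r O q = p" using S e_right by (simp add: r_def O_assoc qq)
  have "q O r = (q O q) O p" by (simp add: O_assoc qp)
  then have qr: "q O r = p" using S e_left by (simp add: qq)
  have "r O r = r O p O q" by (simp add: pq)
  then have rr: "r O r = e" by (simp add: rp qq flip: O_assoc)
  note table = pp qq rr pq qp pr rp qr rq
  have r_conv: "converse r = r" using sym by (simp add: r_def converse_relcomp qp[unfolded r_def])
  have re: "r \<noteq> e"
  proof
    assume "r = e"
    then have "p O r = p" using e_right S by simp
    then show False using pr \<open>p \<noteq> q\<close> by simp
  qed
  have rp': "r \<noteq> p" using rp pp qe by metis
  have rq': "r \<noteq> q" using qr qq pe by metis
  note distinct = pe qe re rp' rq' \<open>p \<noteq> q\<close>
  define K where "K = {e, p, q, r}"
  have K: "K \<subseteq> thin" using e p q S by (auto simp: K_def)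
  have KS: "K \<subseteq> S" using e S by (auto simp: K_def)
  have e_in: "Id_on \<Omega> \<in> K" by (simp add: K_def e_def)
  have K_mult: "x O y \<in> K" if "x \<in> K" "y \<in> K" for x y
    using that unfolding K_def by (elim insertE emptyE) (simp_all add: e_left e_right S e table)
  have "thin_residue S = K"
  proof
    have "closed_subset S K"
      unfolding closed_subset_def
    proof (intro conjI ballI KS)
      fix x y assume xy: "x \<in> K" "y \<in> K"
      then have "converse y = y" using sym r_conv unfolding K_def by (elim insertE emptyE) simp_all
      moreover have "product x y = {x O y}" using thin_comp(2) K KS xy by blast
      ultimately show "product x (converse y) \<subseteq> K" using K_mult xy by simp
    qed
    moreover have "product x (converse x) \<subseteq> K" if "x \<in> S" for x
    proof (cases "x \<in> thick")
      case True
      then have "orth x \<in> {p, q, r}" using sub unfolding perp_set_def r_def by blast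
      then show ?thesis using product_converse[OF True] unfolding K_def e_def by blast
    next
      case False
      then have x: "x \<in> thin" using that thin_or_thick by blast
      have "Id_on \<Omega> \<in> product x (converse x)"
        using product_converse_iff_Id[OF that converse_in[OF that]] by simp
      then have "product x (converse x) = {e}"
        using thin_comp(2)[OF x converse_in[OF that]] by (simp add: e_def)
      then show ?thesis by (simp add: K_def)
    qed
    ultimately show "thin_residue S \<subseteq> K" unfolding thin_residue_def by blast
    show "K \<subseteq> thin_residue S"
      unfolding thin_residue_def
    proof (rule Inter_greatest)
      fix T assume "T \<in> {T. closed_subset S T \<and> (\<Union>u\<in>S. product u (converse u)) \<subseteq> T}"
      then have T: "closed_subset S T" "\<And>x. x \<in> S \<Longrightarrow> product x (converse x) \<subseteq> T" by auto
      have in_T: "e \<in> T" "p \<in> T" "q \<in> T"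
        using T(2)[of u] T(2)[of v] product_converse[OF u(1)] product_converse[OF v(1)]
          valency_part_in[OF u(1)] valency_part_in[OF v(1)] u v by (auto simp: e_def)
      have "product p (converse q) \<subseteq> T" using T(1) in_T unfolding closed_subset_def by blast
      then have "r \<in> T" using thin_comp(2)[OF p(2) S(2)] sym by (simp add: r_def)
      then show "K \<subseteq> T" using in_T by (simp add: K_def)
    qed
  qed
  moreover have "klein_four_group (relation_monoid \<Omega> K)"
    unfolding klein_four_group_def
  proof
    let ?G = "relation_monoid \<Omega> K"
    show "group ?G"
    proof (rule groupI)
      show "\<exists>y\<in>carrier ?G. y \<otimes>\<^bsub>?G\<^esub> x = \<one>\<^bsub>?G\<^esub>" if "x \<in> carrier ?G" for x
      proof (rule bexI[of _ x])
        have "x \<in> K" using that by (simp add: relation_monoid_def)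
        then have "x O x = e" unfolding K_def by (elim insertE emptyE) (simp_all add: e_left e table)
        then show "x \<otimes>\<^bsub>?G\<^esub> x = \<one>\<^bsub>?G\<^esub>" by (simp add: relation_monoid_def e_def)
      qed (rule that)
    qed (use K_mult KS in \<open>simp_all add: relation_monoid_def O_assoc subset_iff Id_comp e_in\<close>)
    let ?H = "integer_mod_group 2 \<times>\<times> integer_mod_group 2"
    \<comment> \<open>The coordinates of \<open>h\<close> are the exponents of \<open>p\<close> and
      of \<open>q\<close>.\<close>
    define h :: "'a rel \<Rightarrow> int \<times> int" where
      "h x = (if x = p \<or> x = r then 1 else 0, if x = q \<or> x = r then 1 else 0)" for x
    have h: "h e = (0, 0)" "h p = (1, 0)" "h q = (0, 1)" "h r = (1, 1)"
      using distinct by (auto simp: h_def)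
    have H: "carrier ?H = {0, 1} \<times> {0, 1}"
      by (auto simp: integer_mod_group_def DirProd_def)
    have "h \<in> hom ?G ?H"
    proof (rule homI)
      fix x y assume "x \<in> carrier ?G" "y \<in> carrier ?G"
      then have xy: "x \<in> K" "y \<in> K" by (simp_all add: relation_monoid_def)
      then show "h x \<in> carrier ?H" unfolding K_def H by (elim insertE emptyE) (simp_all add: h)
      have "h (x O y) = h x \<otimes>\<^bsub>?H\<^esub> h y"
        using xy unfolding K_def
        by (elim insertE emptyE)
          (simp_all add: h table e_left e_right e S integer_mod_group_def DirProd_def)
      then show "h (x \<otimes>\<^bsub>?G\<^esub> y) = h x \<otimes>\<^bsub>?H\<^esub> h y" by (simp add: relation_monoid_def)
    qed
    moreover have "bij_betw h (carrier ?G) (carrier ?H)"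
      unfolding H bij_betw_def
    proof
      show "inj_on h (carrier ?G)"
        by (rule inj_onI, unfold relation_monoid_def K_def partial_object.select_convs, elim insertE emptyE)
          (simp_all add: h)
      show "h ` carrier ?G = {0, 1} \<times> {0, 1}"
        by (auto simp: relation_monoid_def K_def h)
    qed
    ultimately have "h \<in> iso ?G ?H" by (simp add: iso_def)
    then show "?G \<cong> ?H" by (auto simp: is_iso_def)
  qed
  ultimately show ?thesis using K by (simp add: kleinian_def)
qed

end

section \<open>Algebraic isomorphisms of schemes\<close>

locale scheme_isomorphism =
  homogeneous_scheme \<Omega> S + cod: homogeneous_scheme \<Omega>' S'
  for \<Omega> :: "'a set" and S :: "'a rel set" and \<Omega>' :: "'b set" and S' :: "'b rel set" +
  fixes \<phi> :: "'a rel \<Rightarrow> 'b rel"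
  assumes iso: "algebraic_isomorphism S S' \<phi>"
begin

lemma bij: "bij_betw \<phi> S S'"
  using iso by (simp add: algebraic_isomorphism_def)

lemma image_in: "u \<in> S \<Longrightarrow> \<phi> u \<in> S'"
  using bij by (auto simp: bij_betw_def)

lemma image_eq_iff: "u \<in> S \<Longrightarrow> v \<in> S \<Longrightarrow> \<phi> u = \<phi> v \<longleftrightarrow> u = v"
  using bij by (auto simp: bij_betw_def inj_on_def)

lemma image_surj: "u' \<in> S' \<Longrightarrow> \<exists>u\<in>S. u' = \<phi> u"
  using bij by (auto simp: bij_betw_def)

lemma intersection_number_image:
  "u \<in> S \<Longrightarrow> v \<in> S \<Longrightarrow> w \<in> S \<Longrightarrow>
    intersection_number (\<phi> u) (\<phi> v) (\<phi> w) = intersection_number u v w"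
  using iso by (simp add: algebraic_isomorphism_def)

text \<open>Membership in a product means that an intersection number is nonzero, and these numbers
  are preserved.\<close>

lemma product_image:
  assumes "u \<in> S" "v \<in> S"
  shows "cod.product (\<phi> u) (\<phi> v) = \<phi> ` product u v"
proof (intro Set.set_eqI iffI)
  fix w' assume w': "w' \<in> cod.product (\<phi> u) (\<phi> v)"
  then obtain w where w: "w \<in> S" "w' = \<phi> w" using image_surj cod.product_in by blast
  then have "w \<in> product u v"
    using w' cod.product_iff_intersection_number[of "\<phi> u" "\<phi> v" "\<phi> w"]
      product_iff_intersection_number[of u v w] intersection_number_image image_in assms by simp
  then show "w' \<in> \<phi> ` product u v" using w by blast
next
  fix w' assume "w' \<in> \<phi> ` product u v"
  then obtain w where w: "w \<in> product u v" "w' = \<phi> w" by blast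
  then have "w \<in> S" using product_in by blast
  then show "w' \<in> cod.product (\<phi> u) (\<phi> v)"
    using w cod.product_iff_intersection_number[of "\<phi> u" "\<phi> v" "\<phi> w"]
      product_iff_intersection_number[of u v w] intersection_number_image image_in assms by simp
qed

text \<open>The product of \<open>\<phi> (Id_on \<Omega>)\<close> with the identity of the codomain
  is evaluated in two ways: by pulling it back to the domain, and directly.\<close>

lemma image_Id: "\<phi> (Id_on \<Omega>) = Id_on \<Omega>'"
proof -
  obtain u where u: "u \<in> S" "Id_on \<Omega>' = \<phi> u" using image_surj cod.Id_in by blast
  have "cod.product (\<phi> (Id_on \<Omega>)) (Id_on \<Omega>') = {Id_on \<Omega>'}"
    using product_image[OF Id_in u(1)] product_Id_left u by simp
  then show ?thesis using cod.product_Id_right[OF image_in[OF Id_in]] by simp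
qed

lemma image_converse: "u \<in> S \<Longrightarrow> \<phi> (converse u) = converse (\<phi> u)"
proof -
  assume u: "u \<in> S"
  have "Id_on \<Omega> \<in> product u (converse u)" using product_converse_iff_Id u converse_in by blast
  then have "Id_on \<Omega>' \<in> cod.product (\<phi> u) (\<phi> (converse u))"
    unfolding product_image[OF u converse_in[OF u]] image_Id[symmetric] by blast
  then show ?thesis using cod.product_converse_iff_Id[OF image_in image_in] u converse_in by blast
qed

lemma valency_image:
  assumes "u \<in> S" "x \<in> \<Omega>" "x' \<in> \<Omega>'"
  shows "card (\<phi> u `` {x'}) = card (u `` {x})"
  using valency_eq_intersection_number[OF assms(1,2)]
    cod.valency_eq_intersection_number[OF image_in assms(3)] assms(1)
    intersection_number_image[OF assms(1) converse_in Id_in] image_converse image_Id by simp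

end


section \<open>Candidates for the images of points and the constraints between them\<close>

locale quasi_thin_isomorphism =
  scheme_isomorphism \<Omega> S \<Omega>' S' \<phi> + quasi_thin_scheme \<Omega> S
  for \<Omega> :: "'a set" and S :: "'a rel set" and \<Omega>' :: "'b set" and S' :: "'b rel set"
    and \<phi> :: "'a rel \<Rightarrow> 'b rel" +
  fixes \<alpha> :: 'a and \<alpha>' :: 'b
  assumes base: "\<alpha> \<in> \<Omega>" "\<alpha>' \<in> \<Omega>'"
begin

text \<open>Valencies are preserved, so all results on quasi-thin schemes become available for the
  codomain.\<close>

sublocale cod: quasi_thin_scheme \<Omega>' S'
proof
  show "quasi_thin \<Omega>' S'"
    unfolding quasi_thin_def
  proof (intro ballI)
    fix u' x' assume u': "u' \<in> S'" and x': "x' \<in> \<Omega>'"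
    obtain u where u: "u \<in> S" "u' = \<phi> u" using image_surj u' by blast
    show "card (u' `` {x'}) \<in> {1, 2}"
      using valency_image[OF u(1) base(1) x'] quasi_thin u base by (auto simp: quasi_thin_def)
  qed
qed

lemma thick_image: "u \<in> thick \<Longrightarrow> \<phi> u \<in> cod.thick"
  using valency_image[OF _ base] valency_partD[OF _ base(1)] valency_part_in
  by (intro cod.valency_partI[OF image_in base(2)]) auto

lemma linked_image: "linked u v \<Longrightarrow> cod.linked (\<phi> u) (\<phi> v)"
proof -
  assume l: "linked u v"
  then have S: "u \<in> S" "v \<in> S" by (auto simp: linked_def)
  have "inj_on \<phi> (product (converse u) v)"
    using bij product_in by (auto simp: bij_betw_def intro: inj_on_subset)
  then have "card (\<phi> ` product (converse u) v) = 2" using l by (simp add: card_image linked_def)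
  then show ?thesis
    unfolding cod.linked_def using product_image[OF converse_in S(2)] image_converse image_in S by simp
qed

text \<open>A matched pair \<open>(b, b')\<close> is a candidate for \<open>f b = b'\<close>, where \<open>f\<close> is to induce \<open>\<phi>\<close> and \<open>f \<alpha> = \<alpha>'\<close>.\<close>

definition matched :: "'a rel \<Rightarrow> 'a \<Rightarrow> 'b \<Rightarrow> bool" where
  "matched u b b' \<longleftrightarrow> u \<in> S \<and> (\<alpha>, b) \<in> u \<and> (\<alpha>', b') \<in> \<phi> u"

text \<open>The constraint that two candidates put on each other: a map whose values are pairwise
  consistent induces \<phi>. By \<open>consistent_sym\<close> it is enough to look at the pair in
  one direction.\<close>

definition consistent :: "'a \<Rightarrow> 'b \<Rightarrow> 'a \<Rightarrow> 'b \<Rightarrow> bool" where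
  "consistent b b' c c' \<longleftrightarrow> \<phi> (rel b c) = cod.rel b' c'"

lemma matched_points: "matched u b b' \<Longrightarrow> b \<in> \<Omega> \<and> b' \<in> \<Omega>' \<and> u \<in> S"
  using in_points cod.in_points image_in by (fastforce simp: matched_def)

lemma matched_exists: "u \<in> S \<Longrightarrow> \<exists>b b'. matched u b b'"
  using neighbours_nonempty[OF _ base(1)] cod.neighbours_nonempty[OF image_in base(2)]
  by (auto simp: matched_def)

lemma consistent_sym:
  assumes "matched u b b'" "matched v c c'"
  shows "consistent b b' c c' \<longleftrightarrow> consistent c c' b b'"
proof -
  have "b \<in> \<Omega>" "b' \<in> \<Omega>'" "c \<in> \<Omega>" "c' \<in> \<Omega>'" using assms matched_points by blast+
  then show ?thesis
    using rel_converse[of b c] cod.rel_converse[of b' c'] image_converse[OF rel_in]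
    by (auto simp: consistent_def converse_inject)
qed

lemma matched_product:
  assumes b: "matched u b b'" and c: "matched v c c'"
  shows "rel b c \<in> product (converse u) v"
    and "cod.rel b' c' \<in> \<phi> ` product (converse u) v"
proof -
  have S: "u \<in> S" "v \<in> S" using assms matched_points by auto
  show "rel b c \<in> product (converse u) v"
    using productI[OF converse_in[OF S(1)] S(2), of b \<alpha> c] assms by (auto simp: matched_def)
  have "cod.rel b' c' \<in> cod.product (converse (\<phi> u)) (\<phi> v)"
    using cod.productI[OF cod.converse_in[OF image_in[OF S(1)]] image_in[OF S(2)], of b' \<alpha>' c'] assms
    by (auto simp: matched_def)
  then show "cod.rel b' c' \<in> \<phi> ` product (converse u) v"
    using product_image[OF converse_in[OF S(1)] S(2)] image_converse[OF S(1)] by simp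
qed

text \<open>A product with one element forces both colours, so only edges of the graph carry
  constraints.\<close>

lemma not_linked_consistent:
  assumes "matched u b b'" "matched v c c'" "\<not> linked u v"
  shows "consistent b b' c c'"
proof -
  have "card (product (converse u) v) = 1" using not_linked matched_points assms by blast
  then show ?thesis
    using matched_product[OF assms(1,2)] by (auto simp: card_1_singleton_iff consistent_def)
qed

text \<open>The colours \<open>rel b c\<close> and \<open>rel b2 c\<close> are the two elements of
  the product, and \<open>cod.rel b' c'\<close> is the image of exactly one of them.\<close>

lemma consistent_toggle:
  assumes l: "linked u v" and b: "matched u b b'" and c: "matched v c c'"
    and b2: "(\<alpha>, b2) \<in> u" "b2 \<noteq> b"
  shows "consistent b2 b' c c' \<longleftrightarrow> \<not> consistent b b' c c'"
proof -
  have "(\<alpha>, b) \<in> u" "(\<alpha>, c) \<in> v" using b c by (auto simp: matched_def)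
  note two = linked_two[OF l this(1) b2(1) b2(2)[symmetric] this(2)]
  have "rel b c \<in> S" "rel b2 c \<in> S" by (rule product_in[of _ "converse u" v], simp add: two(1))+
  then have "\<phi> (rel b c) \<noteq> \<phi> (rel b2 c)" using two(2) image_eq_iff by simp
  moreover have "cod.rel b' c' = \<phi> (rel b c) \<or> cod.rel b' c' = \<phi> (rel b2 c)"
    using matched_product(2)[OF b c] two(1) by auto
  ultimately show ?thesis by (auto simp: consistent_def)
qed

lemma consistent_toggle':
  assumes l: "linked u v" and b: "matched u b b'" and c: "matched v c c'"
    and b2: "(\<alpha>', b2') \<in> \<phi> u" "b2' \<noteq> b'"
  shows "consistent b b2' c c' \<longleftrightarrow> \<not> consistent b b' c c'"
proof -
  have S: "u \<in> S" "v \<in> S" using b c matched_points by auto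
  have "(\<alpha>', b') \<in> \<phi> u" "(\<alpha>', c') \<in> \<phi> v" using b c by (auto simp: matched_def)
  note two = cod.linked_two[OF linked_image[OF l] this(1) b2(1) b2(2)[symmetric] this(2)]
  have "\<phi> (rel b c) \<in> cod.product (converse (\<phi> u)) (\<phi> v)"
    using matched_product(1)[OF b c] product_image[OF converse_in S(2)] image_converse S by auto
  then have "\<phi> (rel b c) = cod.rel b' c' \<or> \<phi> (rel b c) = cod.rel b2' c'" using two(1) by simp
  then show ?thesis using two(2) by (auto simp: consistent_def)
qed

text \<open>There are two candidates for \<open>c'\<close>, and passing from one to the other
  reverses consistency.\<close>

lemma consistent_exists:
  assumes l: "linked u v" and b: "matched u b b'" and c: "(\<alpha>, c) \<in> v"
  shows "\<exists>c'. matched v c c' \<and> consistent b b' c c'"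
proof -
  have v: "v \<in> S" "v \<in> thick" using l linked_thick by (auto simp: linked_def)
  obtain c1 where c1: "(\<alpha>', c1) \<in> \<phi> v" using cod.neighbours_nonempty[OF image_in[OF v(1)] base(2)] by blast
  obtain c2 where c2: "(\<alpha>', c2) \<in> \<phi> v" "c2 \<noteq> c1" using cod.thick_other[OF thick_image[OF v(2)] c1] by blast
  have m: "matched v c c1" "matched v c c2" using c c1 c2 v by (auto simp: matched_def)
  have "consistent b b' c c1 \<or> consistent b b' c c2"
    using consistent_toggle'[OF linked_sym[OF l] m(1) b c2] consistent_sym[OF b] m by blast
  then show ?thesis using m by blast
qed

lemma matched_move:
  assumes u: "u \<in> thick" and b: "matched u b b'" and b2: "(\<alpha>, b2) \<in> u"
  obtains b2' where "matched u b2 b2'"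
    "\<And>v c c'. linked u v \<Longrightarrow> matched v c c' \<Longrightarrow> consistent b2 b2' c c' \<longleftrightarrow> consistent b b' c c'"
proof (cases "b2 = b")
  case True
  then show ?thesis using that b by blast
next
  case False
  have b': "(\<alpha>', b') \<in> \<phi> u" using b by (simp add: matched_def)
  obtain b2' where b2': "(\<alpha>', b2') \<in> \<phi> u" "b2' \<noteq> b'" using cod.thick_other[OF thick_image[OF u] b'] by blast
  have m: "matched u b2 b'" "matched u b2 b2'" using b b2 b2' by (auto simp: matched_def)
  have "consistent b2 b2' c c' \<longleftrightarrow> consistent b b' c c'" if "linked u v" "matched v c c'" for v c c'
    using consistent_toggle[OF that(1) b that(2) b2 False] consistent_toggle'[OF that(1) m(1) that(2) b2'] by blast
  then show ?thesis using that m by blast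
qed

section \<open>Twisted triangles: triangles of the constraint graph with nontrivial sign\<close>

definition twisted :: "'a rel \<Rightarrow> 'a rel \<Rightarrow> 'a rel \<Rightarrow> bool" where
  "twisted u v w \<longleftrightarrow> linked u v \<and> linked v w \<and> linked u w \<and>
     (\<exists>b b' c c' d d'. matched u b b' \<and> matched v c c' \<and> matched w d d' \<and>
        consistent b b' c c' \<and> consistent c c' d d' \<and> \<not> consistent b b' d d')"

lemma twisted_linked: "twisted u v w \<Longrightarrow> linked u v \<and> linked v w \<and> linked u w"
  by (simp add: twisted_def)

lemma twisted_thick: "twisted u v w \<Longrightarrow> u \<in> thick \<and> v \<in> thick \<and> w \<in> thick"
  using linked_thick twisted_linked by blast

lemma twisted_sym: "twisted u v w \<Longrightarrow> twisted w v u"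
  unfolding twisted_def using linked_sym consistent_sym by meson

text \<open>Replacing \<open>b\<close> by the other \<open>u\<close>-neighbour of \<alpha> reverses
  both edges at \<open>u\<close>, which moves the inconsistent edge from \<open>u\<close>,
  \<open>w\<close> to \<open>u\<close>, \<open>v\<close> without changing the sign of the
  triangle.\<close>

lemma twisted_rotate:
  assumes "twisted u v w"
  shows "twisted v w u"
proof -
  have l: "linked u v" "linked v w" "linked u w" using twisted_linked assms by auto
  obtain b b' c c' d d' where m: "matched u b b'" "matched v c c'" "matched w d d'"
    and c: "consistent b b' c c'" "consistent c c' d d'" "\<not> consistent b b' d d'"
    using assms by (auto simp: twisted_def)
  have "(\<alpha>, b) \<in> u" using m by (simp add: matched_def)
  then obtain b2 where b2: "(\<alpha>, b2) \<in> u" "b2 \<noteq> b" using thick_other twisted_thick[OF assms] by metis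
  have m2: "matched u b2 b'" using m(1) b2 by (simp add: matched_def)
  have "consistent b2 b' d d'" "\<not> consistent b2 b' c c'"
    using consistent_toggle[OF l(1) m(1,2) b2] consistent_toggle[OF l(3) m(1,3) b2] c by auto
  then have "consistent d d' b2 b'" "\<not> consistent c c' b2 b'"
    using consistent_sym[OF m2 m(3)] consistent_sym[OF m2 m(2)] by auto
  then show ?thesis unfolding twisted_def using l m m2 c linked_sym by blast
qed

lemma twisted_swap: "twisted u v w \<Longrightarrow> twisted v u w"
  using twisted_sym twisted_rotate by blast

lemma not_twistedD:
  assumes "\<not> twisted u v w" "linked u v" "linked v w" "linked u w"
    "matched u b b'" "matched v c c'" "matched w d d'"
    "consistent b b' c c'" "consistent c c' d d'"
  shows "consistent b b' d d'"
  using assms unfolding twisted_def by blast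

text \<open>The sign of a triangle is the product of the signs of the three triangles obtained by
  subdividing it with \<open>x\<close>, because each edge at \<open>x\<close> occurs twice.
  Concretely, with \<open>a\<close> chosen consistent with \<open>b\<close>, untwisted triangles
  would pass consistency on to \<open>c\<close>, then to \<open>d\<close>, and finally to the edge
  between \<open>b\<close> and \<open>d\<close>.\<close>

lemma twisted_glue:
  assumes tw: "twisted u v w" and l: "linked x u" "linked x v" "linked x w"
  shows "twisted x u v \<or> twisted x v w \<or> twisted x u w"
proof (rule ccontr)
  assume "\<not> ?thesis"
  then have n: "\<not> twisted x u v" "\<not> twisted x v w" "\<not> twisted u x w" using twisted_swap by blast+
  have l': "linked u v" "linked v w" "linked u w" using twisted_linked tw by auto
  obtain b b' c c' d d' where m: "matched u b b'" "matched v c c'" "matched w d d'"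
    and con: "consistent b b' c c'" "consistent c c' d d'" "\<not> consistent b b' d d'"
    using tw by (auto simp: twisted_def)
  obtain a where "(\<alpha>, a) \<in> x" using neighbours_nonempty[OF _ base(1)] l(1) by (auto simp: linked_def)
  then obtain a' where a: "matched x a a'" "consistent b b' a a'"
    using consistent_exists[OF linked_sym[OF l(1)] m(1)] by blast
  have "consistent a a' b b'" using consistent_sym[OF a(1) m(1)] a(2) by simp
  then have "consistent a a' c c'" using not_twistedD[OF n(1) l(1) l'(1) l(2) a(1) m(1,2)] con by blast
  then have "consistent a a' d d'" using not_twistedD[OF n(2) l(2) l'(2) l(3) a(1) m(2,3)] con by blast
  then show False
    using not_twistedD[OF n(3) linked_sym[OF l(1)] l(3) l'(3) m(1) a(1) m(3) a(2)] con by blast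
qed

section \<open>The relations u^perp, v^perp, w^perp of a twisted triangle\<close>

text \<open>
  Changing one coordinate of a matched pair reverses its consistency with all linked pairs, so
  changing both has no effect. Hence a twisted triangle can be realised at any \<open>b\<close>, \<open>c\<close>, \<open>d\<close>.
\<close>

lemma twisted_product:
  assumes tw: "twisted u v w" and "(\<alpha>, b) \<in> u" "(\<alpha>, c) \<in> v" "(\<alpha>, d) \<in> w"
  shows "product (rel b c) (rel c d) = product (converse u) w"
proof -
  note l = conjunct1[OF twisted_linked[OF tw]] conjunct1[OF conjunct2[OF twisted_linked[OF tw]]]
    conjunct2[OF conjunct2[OF twisted_linked[OF tw]]]
  have t: "u \<in> thick" "v \<in> thick" "w \<in> thick" using twisted_thick[OF tw] by auto
  obtain b0 b0' c0 c0' d0 d0' where m: "matched u b0 b0'" "matched v c0 c0'" "matched w d0 d0'"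
    and con: "consistent b0 b0' c0 c0'" "consistent c0 c0' d0 d0'" "\<not> consistent b0 b0' d0 d0'"
    using tw by (auto simp: twisted_def)
  obtain b' where b': "matched u b b'" and bc:
    "\<And>v c c'. linked u v \<Longrightarrow> matched v c c' \<Longrightarrow> consistent b b' c c' \<longleftrightarrow> consistent b0 b0' c c'"
    using matched_move[OF t(1) m(1) assms(2)] by blast
  obtain c' where c': "matched v c c'" and cc:
    "\<And>x e e'. linked v x \<Longrightarrow> matched x e e' \<Longrightarrow> consistent c c' e e' \<longleftrightarrow> consistent c0 c0' e e'"
    using matched_move[OF t(2) m(2) assms(3)] by blast
  obtain d' where d': "matched w d d'" and dc:
    "\<And>x e e'. linked w x \<Longrightarrow> matched x e e' \<Longrightarrow> consistent d d' e e' \<longleftrightarrow> consistent d0 d0' e e'"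
    using matched_move[OF t(3) m(3) assms(4)] by blast
  have 1: "consistent b b' c c'"
    using bc[OF l(1) c'] cc[OF linked_sym[OF l(1)] m(1)] con(1)
      consistent_sym[OF m(1) m(2)] consistent_sym[OF m(1) c'] by blast
  have 2: "consistent c c' d d'"
    using cc[OF l(2) d'] dc[OF linked_sym[OF l(2)] m(2)] con(2)
      consistent_sym[OF m(2) m(3)] consistent_sym[OF m(2) d'] by blast
  have 3: "\<not> consistent b b' d d'"
    using bc[OF l(3) d'] dc[OF linked_sym[OF l(3)] m(1)] con(3)
      consistent_sym[OF m(1) m(3)] consistent_sym[OF m(1) d'] by blast
  have pts: "b \<in> \<Omega>" "b' \<in> \<Omega>'" "c \<in> \<Omega>" "c' \<in> \<Omega>'" "d \<in> \<Omega>" "d' \<in> \<Omega>'"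
    using b' c' d' matched_points by auto
  let ?P = "product (rel b c) (rel c d)" and ?Q = "product (converse u) w"
  have S: "rel b c \<in> S" "rel c d \<in> S" using rel_in pts by auto
  have P1: "rel b d \<in> ?P" using productI[OF S] rel_mem pts by blast
  have Q1: "rel b d \<in> ?Q" using matched_product[OF b' d'] by simp
  \<comment> \<open>By the two consistent edges, the colour of \<open>(b', d')\<close> is an image
    of an element of \<open>?P\<close>; it is also an image of an element of \<open>?Q\<close>. As
    the third edge is inconsistent, this common element \<open>x\<close> differs from
    \<open>rel b d\<close>, which lies in both sets. Neither set has more than two elements, so they
    agree.\<close>
  have "cod.rel b' d' \<in> cod.product (cod.rel b' c') (cod.rel c' d')"
    using cod.productI[OF cod.rel_in cod.rel_in] cod.rel_mem pts by blast
  then have "cod.rel b' d' \<in> \<phi> ` ?P" using product_image[OF S] 1 2 by (simp add: consistent_def)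
  then obtain x where x: "x \<in> ?P" "cod.rel b' d' = \<phi> x" by blast
  obtain y where y: "y \<in> ?Q" "cod.rel b' d' = \<phi> y" using matched_product(2)[OF b' d'] by blast
  have "x = y" using x y image_eq_iff product_in by metis
  have ne: "x \<noteq> rel b d" using 3 x by (auto simp: consistent_def)
  have two: "X = {rel b d, x}" if "card X = 1 \<or> card X = 2" "rel b d \<in> X" "x \<in> X" for X
    using that ne by (auto simp: card_1_singleton_iff card_2_iff)
  have "?P = {rel b d, x}" using two[OF _ P1 x(1)] product_card[OF S] by blast
  moreover have "?Q = {rel b d, x}"
    using two[OF _ Q1] y(1) \<open>x = y\<close> l(3) by (auto simp: linked_def)
  ultimately show ?thesis by simp
qed

text \<open>With equal perps, \<open>product (converse u) v\<close> contains a thin relation.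
  Realising it as \<open>rel b c\<close> makes the left side of \<open>twisted_product\<close> a
  singleton, whereas the right side has two elements.\<close>

lemma twisted_orth_neq:
  assumes tw: "twisted u v w"
  shows "orth u \<noteq> orth v"
proof
  assume eq: "orth u = orth v"
  have l: "linked u v" "linked u w" and t: "u \<in> thick" "v \<in> thick" and S: "u \<in> S" "v \<in> S" "w \<in> S"
    using twisted_linked[OF tw] twisted_thick[OF tw] by (auto simp: linked_def)
  obtain a where a: "a \<in> product (converse u) v" "a \<in> thin"
    using linked_orth_thin[OF t eq] l(1) by (auto simp: linked_def)
  obtain c where c: "(\<alpha>, c) \<in> v" using neighbours_nonempty[OF S(2) base(1)] by blast
  obtain d where d: "(\<alpha>, d) \<in> w" using neighbours_nonempty[OF S(3) base(1)] by blast
  have "a \<in> (\<lambda>x. rel x c) ` (u `` {\<alpha>})" using product_eq_left[OF converse_in[OF S(1)] S(2) c] a by simp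
  then obtain b where b: "(\<alpha>, b) \<in> u" "a = rel b c" by blast
  have "rel c d \<in> S" using rel_in in_points S c d by blast
  then have "card (product (rel b c) (rel c d)) = 1"
    using thin_product_left[OF a(2)] b(2) by fastforce
  then show False using twisted_product[OF tw b(1) c d] l(2) by (simp add: linked_def)
qed

text \<open>A path with colours \<open>orth v\<close>, \<open>w\<close> from \<open>s\<close> to
  \<open>r\<close> is replaced by one through another midpoint. A common \<open>v\<close>-neighbour
  \<open>c\<close> of the first two points and a \<open>u\<close>-neighbour \<open>b\<close> of
  \<open>s\<close> give, through \<open>twisted_product\<close>, a point \<open>y\<close> with
  \<open>(y, b)\<close> in \<open>u\<close> and \<open>(y, r)\<close> in \<open>w\<close>. Then
  \<open>s\<close> and \<open>y\<close> share \<open>b\<close>, so they are related by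
  \<open>orth u\<close> once they are known to be distinct.\<close>

lemma twisted_orth_subset:
  assumes tw: "twisted u v w"
  shows "product (orth v) w \<subseteq> product (orth u) w"
proof
  fix x assume x: "x \<in> product (orth v) w"
  have t: "u \<in> thick" "v \<in> thick" "w \<in> thick" using twisted_thick[OF tw] by auto
  then have S: "u \<in> S" "v \<in> S" "w \<in> S" using valency_part_in by auto
  obtain s r where sr: "(s, r) \<in> x" using nonempty[OF product_in[OF x]] by blast
  obtain z where z: "(s, z) \<in> orth v" "(z, r) \<in> w" using product_path[OF x sr] by blast
  obtain c where c: "(s, c) \<in> v" "(z, c) \<in> v" using orth_common[OF t(2) z(1)] by blast
  have pts: "s \<in> \<Omega>" "r \<in> \<Omega>" "c \<in> \<Omega>" using in_points[OF S(2) c(1)] in_points[OF S(3) z(2)] by auto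
  obtain b where b: "(s, b) \<in> u" using neighbours_nonempty[OF S(1) pts(1)] by blast
  have bO: "b \<in> \<Omega>" using in_points[OF S(1) b] by blast
  have a: "rel b c \<in> product (converse u) v" using productI[OF converse_in[OF S(1)] S(2) _ c(1)] b by blast
  have e: "rel c r \<in> product (converse v) w" using productI[OF converse_in[OF S(2)] S(3) _ z(2)] c by blast
  \<comment> \<open>Since \<open>twisted_product\<close> speaks about neighbours of \<alpha>, the
    colours \<open>rel b c\<close> and \<open>rel c r\<close> are realised there with a common point
    \<open>c0\<close>.\<close>
  obtain c0 where c0: "(\<alpha>, c0) \<in> v" using neighbours_nonempty[OF S(2) base(1)] by blast
  obtain b0 where b0: "(\<alpha>, b0) \<in> u" "rel b c = rel b0 c0"
    using a product_eq_left[OF converse_in[OF S(1)] S(2) c0] by auto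
  obtain d0 where d0: "(\<alpha>, d0) \<in> w" "rel c r = rel c0 d0"
    using e product_eq_right[OF converse_in[OF S(2)] S(3), of c0 \<alpha>] c0 by auto
  have "rel b r \<in> product (rel b c) (rel c r)"
    using productI[OF rel_in rel_in] rel_mem pts bO by blast
  then have br: "rel b r \<in> product (converse u) w"
    using twisted_product[OF tw b0(1) c0 d0(1)] b0 d0 by simp
  obtain y where y: "(y, b) \<in> u" "(y, r) \<in> w" using product_path[OF br rel_mem[OF bO pts(2)]] by blast
  have xr: "x = rel s r" using rel_eqI[OF product_in[OF x] sr] by simp
  have "s \<noteq> y"
  proof
    assume "s = y"
    then have "x = w" using xr rel_eqI[OF S(3)] y by blast
    then show False
      using orth_notin_product[OF t(2,3)] twisted_orth_neq[OF twisted_rotate[OF tw]] x by blast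
  qed
  then have "(s, y) \<in> orth u" using orth_eqI(2)[OF t(1) b y(1)] by blast
  then show "x \<in> product (orth u) w" using productI[OF orth_in[OF t(1)] S(3) _ y(2)] xr by blast
qed

lemma twisted_orth_product: "twisted u v w \<Longrightarrow> product (orth v) w = product (orth u) w"
  by (rule subset_antisym[OF twisted_orth_subset twisted_orth_subset[OF twisted_swap]])

text \<open>Continue an edge \<open>(x, y)\<close> of \<open>orth u\<close> by a
  \<open>w\<close>-edge to \<open>z\<close>. By \<open>twisted_orth_product\<close> there is also a
  path from \<open>x\<close> to \<open>z\<close> with colours \<open>orth v\<close>,
  \<open>w\<close>; its midpoint differs from \<open>y\<close> and shares the
  \<open>w\<close>-neighbour \<open>z\<close> with it.\<close>

lemma twisted_orth_in:
  assumes tw: "twisted u v w"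
  shows "orth u \<in> product (orth v) (orth w)"
proof -
  have t: "u \<in> thick" "v \<in> thick" "w \<in> thick" using twisted_thick[OF tw] by auto
  have S: "w \<in> S" using t valency_part_in by auto
  obtain x y where xy: "(x, y) \<in> orth u" using nonempty[OF orth_in[OF t(1)]] by blast
  then have pts: "x \<in> \<Omega>" "y \<in> \<Omega>" using in_points[OF orth_in[OF t(1)]] by auto
  obtain z where z: "(y, z) \<in> w" using neighbours_nonempty[OF S pts(2)] by blast
  have zO: "z \<in> \<Omega>" using in_points[OF S z] by blast
  have "rel x z \<in> product (orth v) w"
    using productI[OF orth_in[OF t(1)] S xy z] twisted_orth_product[OF tw] by simp
  then obtain y2 where y2: "(x, y2) \<in> orth v" "(y2, z) \<in> w"
    using product_path rel_mem[OF pts(1) zO] by blast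
  have "y2 \<noteq> y"
    using partition_block_unique[OF partition orth_in[OF t(1)] orth_in[OF t(2)] xy] y2(1)
      twisted_orth_neq[OF tw] by blast
  then have "(y2, y) \<in> orth w" using orth_eqI(2)[OF t(3) y2(2) z] by blast
  then show ?thesis
    using productI[OF orth_in[OF t(2)] orth_in[OF t(3)] y2(1)] rel_eqI[OF orth_in[OF t(1)] xy] by metis
qed

text \<open>If \<open>orth v\<close> is thin, then \<open>orth w\<close> lies in a product of two
  thin relations. If \<open>orth v\<close> is thick, its product with \<open>w\<close> equals that
  of the thin \<open>orth u\<close> with \<open>w\<close> and so has one element; then
  \<open>single_product_orth\<close>, applied to \<open>orth v\<close> and \<open>w\<close>, makes
  \<open>orth w\<close> thin.\<close>

lemma twisted_orth_thin:
  assumes tw: "twisted u v w" and o: "orth u \<in> thin"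
  shows "orth w \<in> thin"
proof (rule ccontr)
  assume "orth w \<notin> thin"
  have t: "u \<in> thick" "v \<in> thick" "w \<in> thick" using twisted_thick[OF tw] by auto
  note S = orth_in[OF t(1)] orth_in[OF t(2)] orth_in[OF t(3)]
  have wS: "w \<in> S" using t valency_part_in by blast
  have "orth v \<in> thick"
  proof (rule ccontr)
    assume "orth v \<notin> thick"
    then have v: "orth v \<in> thin" using thin_or_thick S by blast
    have "orth w \<in> product (orth u) (orth v)" using twisted_orth_in twisted_rotate tw by blast
    then have "orth w \<in> thin" using thin_comp(2)[OF o S(2)] thin_comp_valency[OF o v] by simp
    then show False using \<open>orth w \<notin> thin\<close> by simp
  qed
  moreover obtain y where "product (orth u) w = {y}" using thin_product_left[OF o wS] by blast
  then have "card (product (converse (orth v)) w) = 1"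
    using twisted_orth_product[OF tw] orth_converse[OF t(2)] by simp
  ultimately have "orth (orth v) = orth w" "orth (orth v) \<in> thin"
    using single_product_orth[OF _ t(3)] by blast+
  then show False using \<open>orth w \<notin> thin\<close> by simp
qed

lemma twisted_orth_comp:
  assumes tw: "twisted u v w" and o: "orth u \<in> thin"
  shows "orth v \<in> thin" and "orth w \<in> thin" and "orth w = orth u O orth v"
proof -
  have "v \<in> thick" using twisted_thick[OF tw] by auto
  show "orth w \<in> thin" using twisted_orth_thin tw o by blast
  show "orth v \<in> thin" using twisted_orth_thin[OF twisted_rotate[OF twisted_swap[OF tw]] o] .
  have "orth w \<in> product (orth u) (orth v)" using twisted_orth_in twisted_rotate tw by blast
  then show "orth w = orth u O orth v" using thin_comp(2)[OF o orth_in[OF \<open>v \<in> thick\<close>]] by simp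
qed

text \<open>All three perps are thick here. Starting from an edge \<open>(x, p)\<close> of
  \<open>orth u\<close>, each of the two \<open>w\<close>-neighbours of \<open>p\<close> yields an
  \<open>orth v\<close>-neighbour of \<open>x\<close> that is related to \<open>p\<close> by
  \<open>orth w\<close>. By \<open>thick_orth_share\<close> these two points differ, so they are the
  whole \<open>orth v\<close>-neighbourhood of \<open>x\<close>. Hence the product of
  \<open>orth u\<close> and \<open>orth v\<close> is just \<open>orth w\<close>, and
  \<open>single_product_orth\<close> applies.\<close>

lemma twisted_orth_thick:
  assumes tw: "twisted u v w" and o: "orth u \<in> thick"
  shows "orth (orth u) \<in> thin"
proof -
  have t: "u \<in> thick" "v \<in> thick" "w \<in> thick" using twisted_thick[OF tw] by auto
  note S = orth_in[OF t(1)] orth_in[OF t(2)] orth_in[OF t(3)]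
  have wS: "w \<in> S" using t valency_part_in by blast
  have "orth v \<notin> thin" "orth w \<notin> thin"
    using twisted_orth_comp[OF twisted_swap[OF tw]] twisted_orth_comp[OF twisted_sym[OF tw]]
      thin_not_thick o by blast+
  then have ow: "orth v \<in> thick" "orth w \<in> thick" using thin_or_thick S by blast+
  obtain x p where xp: "(x, p) \<in> orth u" using nonempty[OF S(1)] by blast
  then have pts: "x \<in> \<Omega>" "p \<in> \<Omega>" using in_points S by blast+
  obtain d where d: "(p, d) \<in> w" using neighbours_nonempty[OF wS pts(2)] by blast
  obtain d' where d': "(p, d') \<in> w" "d' \<noteq> d" using thick_other[OF t(3) d] by blast
  have ex: "\<exists>q. (x, q) \<in> orth v \<and> (q, e) \<in> w \<and> (p, q) \<in> orth w" if e: "(p, e) \<in> w" for e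
  proof -
    have "rel x e \<in> product (orth v) w"
      using productI[OF S(1) wS xp e] twisted_orth_product[OF tw] by simp
    then obtain q where q: "(x, q) \<in> orth v" "(q, e) \<in> w"
      using product_path rel_mem[OF pts(1)] in_points[OF wS e] by blast
    have "p \<noteq> q"
      using partition_block_unique[OF partition S(1,2) xp] q(1) twisted_orth_neq[OF tw] by blast
    then show ?thesis using q orth_eqI(2)[OF t(3) e q(2)] by blast
  qed
  obtain q where q: "(x, q) \<in> orth v" "(q, d) \<in> w" "(p, q) \<in> orth w" using ex[OF d] by blast
  obtain q' where q': "(x, q') \<in> orth v" "(q', d') \<in> w" "(p, q') \<in> orth w" using ex[OF d'(1)] by blast
  have "q \<noteq> q'" using thick_orth_share[OF t(3) ow(2) q(3) d q(2) d'(1)] q'(2) d'(2) by blast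
  then have "product (converse (orth u)) (orth v) = {rel p q, rel p q'}"
    using product_thick[OF o ow(1) xp q(1) q'(1)] by blast
  then have "card (product (converse (orth u)) (orth v)) = 1"
    using rel_eqI[OF S(3) q(3)] rel_eqI[OF S(3) q'(3)] by simp
  then show ?thesis using single_product_orth[OF o ow(1)] by blast
qed

theorem not_twisted:
  assumes nk: "\<not> kleinian \<Omega> S"
  shows "\<not> twisted u v w"
proof
  assume tw: "twisted u v w"
  have t: "u \<in> thick" "v \<in> thick" "w \<in> thick" using twisted_thick[OF tw] by auto
  have neq: "orth u \<noteq> orth v" using twisted_orth_neq tw by blast
  have link: "linked x y" if "x \<in> thick" "orth x \<notin> {orth u, orth v, orth w}" "y \<in> {u, v, w}" for x y
    using linked_if_orth_neq[of x y] that t by fastforce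
  have glue: "twisted x u v \<or> twisted x v w \<or> twisted x u w"
    if "x \<in> thick" "orth x \<notin> {orth u, orth v, orth w}" for x
    using twisted_glue[OF tw] link[OF that] by simp
  show False
  proof (cases "orth u \<in> thin")
    case True
    note th = twisted_orth_comp[OF tw True]
    have u_eq: "orth u = orth v O orth w" using twisted_orth_comp(3)[OF twisted_rotate[OF tw] th(1)] .
    have v_eq: "orth v = orth u O orth w"
      using twisted_orth_comp(3)[OF twisted_rotate[OF twisted_swap[OF tw]] True] .
    \<comment> \<open>Subdividing by a further \<open>x\<close> would leave a twisted triangle
      through \<open>x\<close> and two of the vertices. Then \<open>orth x\<close> is the product of
      their perps, which is the perp of the third vertex.\<close>
    have "orth x \<in> {orth u, orth v, orth w}" if x: "x \<in> thick" for x
    proof (rule ccontr)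
      assume n: "orth x \<notin> {orth u, orth v, orth w}"
      have eq: "orth x = orth y O orth z" if "twisted x y z" "orth y \<in> thin" for y z
        using twisted_orth_comp(3)[OF twisted_rotate[OF that(1)] that(2)] .
      consider "twisted x u v" | "twisted x v w" | "twisted x u w" using glue[OF x n] by blast
      then show False
      proof cases
        case 1
        from eq[OF this True] n show False by (simp flip: th(3))
      next
        case 2
        from eq[OF this th(1)] n show False by (simp flip: u_eq)
      next
        case 3
        from eq[OF this True] n show False by (simp flip: v_eq)
      qed
    qed
    then have "perp_set \<Omega> S \<subseteq> {orth u, orth v, orth u O orth v}"
      unfolding perp_set_def th(3)[symmetric] by blast
    moreover have "orth u \<in> perp_set \<Omega> S" "orth v \<in> perp_set \<Omega> S"
      using t unfolding perp_set_def by blast+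
    ultimately show False using kleinianI[OF _ True _ th(1) neq] nk by blast
  next
    case False
    then have o: "orth u \<in> thick" using thin_or_thick orth_in[OF t(1)] by blast
    have "orth v \<notin> thin" "orth w \<notin> thin"
      using twisted_orth_comp[OF twisted_swap[OF tw]] twisted_orth_comp[OF twisted_sym[OF tw]] False by blast+
    moreover have th: "orth (orth u) \<in> thin" using twisted_orth_thick[OF tw o] .
    \<comment> \<open>The subdividing vertex is \<open>orth u\<close> itself. Its perp is thin, so a
      twisted triangle through it would make the perps of its other two vertices thin.\<close>
    ultimately have "orth (orth u) \<notin> {orth u, orth v, orth w}"
      using False by (metis insertE singletonD)
    then show False using glue[OF o] twisted_orth_comp(1)[OF _ th] False \<open>orth v \<notin> thin\<close> by blast
  qed
qed

end

section \<open>Transport of relations and configurations along a bijection\<close>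

definition transport :: "('a \<Rightarrow> 'b) \<Rightarrow> 'a rel \<Rightarrow> 'b rel" where
  "transport f u = map_prod f f ` u"

lemma coherent_subset: "coherent_configuration \<Omega> T \<Longrightarrow> u \<in> T \<Longrightarrow> u \<subseteq> \<Omega> \<times> \<Omega>"
  by (auto simp: coherent_configuration_def partition_on_def)

context
  fixes f :: "'a \<Rightarrow> 'b" and \<Omega> :: "'a set" and \<Omega>' :: "'b set"
  assumes f: "bij_betw f \<Omega> \<Omega>'"
begin

lemma inj_on_map_prod: "inj_on (map_prod f f) (\<Omega> \<times> \<Omega>)"
  using f by (auto simp: bij_betw_def inj_on_def)

lemma transport_iff:
  assumes "u \<subseteq> \<Omega> \<times> \<Omega>" "x \<in> \<Omega>" "y \<in> \<Omega>"
  shows "(f x, f y) \<in> transport f u \<longleftrightarrow> (x, y) \<in> u"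
  using inj_on_image_mem_iff[OF inj_on_map_prod, of "(x, y)" u] assms by (simp add: transport_def)

lemma inj_on_transport: "inj_on (transport f) (Pow (\<Omega> \<times> \<Omega>))"
  unfolding transport_def using inj_on_map_prod by (rule inj_on_image_Pow)

lemma card_transport_path:
  assumes "u \<subseteq> \<Omega> \<times> \<Omega>" "v \<subseteq> \<Omega> \<times> \<Omega>" "x \<in> \<Omega>" "y \<in> \<Omega>"
  shows "card (transport f u `` {f x} \<inter> converse (transport f v) `` {f y}) =
    card (u `` {x} \<inter> converse v `` {y})"
proof -
  have inj: "inj_on f \<Omega>" using f by (simp add: bij_betw_def)
  have "transport f u `` {f x} \<inter> converse (transport f v) `` {f y} =
      f ` (u `` {x} \<inter> converse v `` {y})"
  proof (intro subset_antisym subsetI)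
    fix z' assume z': "z' \<in> transport f u `` {f x} \<inter> converse (transport f v) `` {f y}"
    then have "z' \<in> f ` \<Omega>" using assms(1) by (auto simp: transport_def)
    then obtain z where z: "z \<in> \<Omega>" "z' = f z" by blast
    then show "z' \<in> f ` (u `` {x} \<inter> converse v `` {y})"
      using z' transport_iff[OF assms(1,3), of z] transport_iff[OF assms(2) _ assms(4), of z] by auto
  qed (auto simp: transport_def)
  moreover have "inj_on f (u `` {x} \<inter> converse v `` {y})"
    using inj assms(1) by (auto intro: inj_on_subset)
  ultimately show ?thesis by (simp add: card_image)
qed

lemma transport_intersection_number:
  assumes "u \<subseteq> \<Omega> \<times> \<Omega>" "v \<subseteq> \<Omega> \<times> \<Omega>" "w \<subseteq> \<Omega> \<times> \<Omega>"
  shows "intersection_number (transport f u) (transport f v) (transport f w) = intersection_number u v w"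
proof -
  have "(\<forall>(\<alpha>, \<gamma>)\<in>transport f w.
          card (transport f u `` {\<alpha>} \<inter> converse (transport f v) `` {\<gamma>}) = c) \<longleftrightarrow>
        (\<forall>(\<alpha>, \<gamma>)\<in>w. card (u `` {\<alpha>} \<inter> converse v `` {\<gamma>}) = c)" (is "?L \<longleftrightarrow> ?R") for c
  proof -
    have "?L \<longleftrightarrow> (\<forall>(\<alpha>, \<gamma>)\<in>w.
        card (transport f u `` {f \<alpha>} \<inter> converse (transport f v) `` {f \<gamma>}) = c)"
      unfolding transport_def[of f w] by (simp add: case_prod_beta)
    also have "\<dots> \<longleftrightarrow> ?R"
      using card_transport_path[OF assms(1,2)] assms(3) by (intro ball_cong) auto
    finally show ?thesis .
  qed
  then show ?thesis unfolding intersection_number_def by simp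
qed

lemma transport_is_union:
  "is_union T u \<Longrightarrow> is_union (transport f ` T) (transport f u)"
  unfolding is_union_def transport_def by (metis image_Union image_mono)

lemma coherent_configuration_transport:
  assumes T: "coherent_configuration \<Omega> T"
  shows "coherent_configuration \<Omega>' (transport f ` T)"
  unfolding coherent_configuration_def
proof (intro conjI ballI)
  note sub = coherent_subset[OF T]
  show "finite \<Omega>'" using T f bij_betw_finite by (auto simp: coherent_configuration_def)
  have "map_prod f f ` (\<Omega> \<times> \<Omega>) = \<Omega>' \<times> \<Omega>'" using f by (auto simp: bij_betw_def)
  moreover note inj_on_map_prod
  moreover have part: "partition_on (\<Omega> \<times> \<Omega>) T" using T by (simp add: coherent_configuration_def)
  ultimately have "partition_on (\<Omega>' \<times> \<Omega>') (transport f ` T - {{}})"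
    using partition_on_inj_image[of "\<Omega> \<times> \<Omega>" T "map_prod f f"] by (simp add: transport_def[abs_def])
  moreover have "{} \<notin> transport f ` T" using partition_onD3[OF part] by (auto simp: transport_def)
  ultimately show "partition_on (\<Omega>' \<times> \<Omega>') (transport f ` T)" by simp
  have "f ` \<Omega> = \<Omega>'" using f by (simp add: bij_betw_def)
  then have "transport f (Id_on \<Omega>) = Id_on \<Omega>'" by (auto simp: transport_def Id_on_def)
  then show "is_union (transport f ` T) (Id_on \<Omega>')"
    using transport_is_union[of T "Id_on \<Omega>"] T by (simp add: coherent_configuration_def)
  show "converse u' \<in> transport f ` T" if u': "u' \<in> transport f ` T" for u'
  proof -
    obtain u where u: "u \<in> T" "u' = transport f u" using u' by blast
    have "converse u' = transport f (converse u)" unfolding u transport_def by force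
    then show ?thesis using T u by (auto simp: coherent_configuration_def)
  qed
  fix u' v' w' assume "u' \<in> transport f ` T" "v' \<in> transport f ` T" "w' \<in> transport f ` T"
  then obtain u v w where T': "u \<in> T" "v \<in> T" "w \<in> T"
    and eq: "u' = transport f u" "v' = transport f v" "w' = transport f w" by blast
  obtain c where c: "\<forall>(\<alpha>, \<gamma>)\<in>w. card (u `` {\<alpha>} \<inter> converse v `` {\<gamma>}) = c"
    using T T' unfolding coherent_configuration_def by meson
  have "card (u' `` {x'} \<inter> converse v' `` {y'}) = c" if xy': "(x', y') \<in> w'" for x' y'
  proof -
    obtain x y where xy: "(x, y) \<in> w" "x' = f x" "y' = f y" using xy' by (auto simp: eq transport_def)
    then have "x \<in> \<Omega>" "y \<in> \<Omega>" using sub[OF T'(3)] by auto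
    then show ?thesis
      using card_transport_path[OF sub sub] T' bspec[OF c xy(1)] xy(2,3) by (simp add: eq)
  qed
  then show "\<exists>c. \<forall>(\<alpha>, \<gamma>)\<in>w'. card (u' `` {\<alpha>} \<inter> converse v' `` {\<gamma>}) = c" by blast
qed

lemma extends_at_transport:
  assumes "extends_at \<Omega> S \<alpha> T"
  shows "extends_at \<Omega>' (transport f ` S) (f \<alpha>) (transport f ` T)"
proof -
  have T: "coherent_configuration \<Omega> T" "{(\<alpha>, \<alpha>)} \<in> T" "\<And>u. u \<in> S \<Longrightarrow> is_union T u"
    using assms by (auto simp: extends_at_def)
  have "transport f {(\<alpha>, \<alpha>)} = {(f \<alpha>, f \<alpha>)}" by (simp add: transport_def)
  then have "{(f \<alpha>, f \<alpha>)} \<in> transport f ` T" using T(2) by (metis imageI)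
  then show ?thesis
    unfolding extends_at_def using coherent_configuration_transport[OF T(1)] transport_is_union T(3)
    by blast
qed

end

lemma transport_inverse:
  assumes "bij_betw f \<Omega> \<Omega>'" "u \<subseteq> \<Omega> \<times> \<Omega>"
  shows "transport (inv_into \<Omega> f) (transport f u) = u"
proof -
  have "map_prod (inv_into \<Omega> f) (inv_into \<Omega> f) (map_prod f f p) = p" if "p \<in> u" for p
    using that assms by (cases p) (auto simp: bij_betw_inv_into_left)
  then show ?thesis by (simp add: transport_def image_image cong: image_cong)
qed

lemma transport_inverse':
  assumes "bij_betw f \<Omega> \<Omega>'" "u \<subseteq> \<Omega>' \<times> \<Omega>'"
  shows "transport f (transport (inv_into \<Omega> f) u) = u"
proof -
  have "map_prod f f (map_prod (inv_into \<Omega> f) (inv_into \<Omega> f) p) = p" if "p \<in> u" for p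
    using that assms by (cases p) (auto simp: bij_betw_inv_into_right)
  then show ?thesis by (simp add: transport_def image_image cong: image_cong)
qed

text \<open>For minimality, a competing configuration on the target is pulled back along the inverse
  bijection, compared with the point extension there, and pushed forward again.\<close>

lemma point_extension_transport:
  assumes f: "bij_betw f \<Omega> \<Omega>'" and S: "coherent_configuration \<Omega> S" and \<alpha>: "\<alpha> \<in> \<Omega>"
  shows "point_extension \<Omega>' (transport f ` S) (f \<alpha>) = transport f ` point_extension \<Omega> S \<alpha>"
proof (rule point_extension_unique)
  let ?g = "inv_into \<Omega> f"
  note least = point_extension_least[OF S \<alpha>]
  show "extends_at \<Omega>' (transport f ` S) (f \<alpha>) (transport f ` point_extension \<Omega> S \<alpha>)"
    by (rule extends_at_transport[OF f least(1)])
  fix T' assume T': "extends_at \<Omega>' (transport f ` S) (f \<alpha>) T'"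
  have "transport ?g ` transport f ` S = S"
    using transport_inverse[OF f coherent_subset[OF S]] by (simp add: image_image)
  moreover have "?g (f \<alpha>) = \<alpha>" using f \<alpha> by (rule bij_betw_inv_into_left)
  ultimately have T: "extends_at \<Omega> S \<alpha> (transport ?g ` T')"
    using extends_at_transport[OF bij_betw_inv_into[OF f] T'] by simp
  have round_trip: "transport f ` transport ?g ` T' = T'"
    using transport_inverse'[OF f coherent_subset, of T'] T' by (simp add: image_image extends_at_def)
  show "\<forall>u\<in>transport f ` point_extension \<Omega> S \<alpha>. is_union T' u"
    using transport_is_union[OF f least(2)[OF T]] round_trip by auto
qed

section \<open>Construction of a bijection inducing \<phi>\<close>

context quasi_thin_isomorphism
begin

text \<open>Two thick relations \<open>u\<close> and \<open>x\<close> with different perps form an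
  edge of the graph, and every thick relation is linked to at least one of them, since being
  unlinked to both would make their perps equal. Fixing mutually consistent candidates at
  \<open>u\<close> and \<open>x\<close> therefore settles the binary choice at every thick
  relation.\<close>

lemma exists_inducing_bijection:
  assumes nk: "\<not> kleinian \<Omega> S" and two: "card (perp_set \<Omega> S) \<ge> 2"
  shows "\<exists>f. bij_betw f \<Omega> \<Omega>' \<and> f \<alpha> = \<alpha>' \<and>
    (\<forall>x\<in>\<Omega>. \<forall>y\<in>\<Omega>. \<phi> (rel x y) = cod.rel (f x) (f y))"
proof -
  have fin: "finite (perp_set \<Omega> S)" using two card.infinite by fastforce
  have "\<not> card (perp_set \<Omega> S) \<le> Suc 0" using two by simp
  then have "\<exists>p\<in>perp_set \<Omega> S. \<exists>q\<in>perp_set \<Omega> S. p \<noteq> q"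
    using card_le_Suc0_iff_eq[OF fin] by blast
  then obtain u x where u: "u \<in> thick" and x: "x \<in> thick" and neq: "orth u \<noteq> orth x"
    unfolding perp_set_def by blast
  have ux: "linked u x" using linked_if_orth_neq u x neq by blast
  have uS: "u \<in> S" using u valency_part_in by blast
  have good: "consistent b b' d d'"
    if "linked r s" "linked s t" "linked r t" "matched r b b'" "matched s c c'" "matched t d d'"
      "consistent b b' c c'" "consistent c c' d d'" for r s t b b' c c' d d'
    using not_twistedD[OF not_twisted[OF nk] that] .
  obtain b0 b0' where b0: "matched u b0 b0'" using matched_exists[OF uS] by blast
  obtain c0 where "(\<alpha>, c0) \<in> x" using neighbours_nonempty[OF valency_part_in[OF x] base(1)] by blast
  then obtain c0' where c0: "matched x c0 c0'" and bc: "consistent b0 b0' c0 c0'"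
    using consistent_exists[OF ux b0] by blast
  have cb: "consistent c0 c0' b0 b0'" using bc consistent_sym[OF b0 c0] by simp
  define F where "F b b' \<longleftrightarrow> matched (rel \<alpha> b) b b' \<and> consistent b0 b0' b b' \<and> consistent c0 c0' b b'"
    for b b'
  have ex: "\<exists>b'. F b b'" if b: "b \<in> \<Omega>" for b
  proof -
    let ?v = "rel \<alpha> b"
    have v: "?v \<in> S" "(\<alpha>, b) \<in> ?v" using rel_in rel_mem base b by auto
    show ?thesis
    \<comment> \<open>Consistency is arranged with one linked reference vertex. If both are linked,
      it passes from \<open>b0\<close> to \<open>c0\<close> along the untwisted triangle
      \<open>x\<close>, \<open>u\<close>, \<open>?v\<close>; an unlinked reference vertex imposes no
      condition.\<close>
    proof (cases "linked u ?v")
      case True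
      then obtain b' where b': "matched ?v b b'" "consistent b0 b0' b b'"
        using consistent_exists[OF True b0 v(2)] by blast
      have "consistent c0 c0' b b'"
        using good[OF linked_sym[OF ux] True _ c0 b0 b'(1) cb b'(2)] not_linked_consistent[OF c0 b'(1)]
        by blast
      then show ?thesis using b' by (auto simp: F_def)
    next
      case nu: False
      show ?thesis
      proof (cases "linked x ?v")
        case True
        then obtain b' where b': "matched ?v b b'" "consistent c0 c0' b b'"
          using consistent_exists[OF True c0 v(2)] by blast
        then show ?thesis using not_linked_consistent[OF b0 _ nu] by (auto simp: F_def)
      next
        case False
        obtain b' where "(\<alpha>', b') \<in> \<phi> ?v"
          using cod.neighbours_nonempty[OF image_in[OF v(1)] base(2)] by blast
        then have "matched ?v b b'" using v by (simp add: matched_def)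
        then show ?thesis
          using not_linked_consistent[OF b0 _ nu] not_linked_consistent[OF c0 _ False]
          by (auto simp: F_def)
      qed
    qed
  qed
  have pair: "consistent b b' c c'" if F: "F b b'" "F c c'" for b b' c c'
  proof (cases "linked (rel \<alpha> b) (rel \<alpha> c)")
    case False
    then show ?thesis using not_linked_consistent F by (auto simp: F_def)
  next
    case l: True
    define v where "v = rel \<alpha> b"
    define w where "w = rel \<alpha> c"
    have vw: "linked v w" using l by (simp add: v_def w_def)
    have v: "v \<in> thick" and w: "w \<in> thick" using linked_thick[OF vw] by auto
    have mb: "matched v b b'" and mc: "matched w c c'"
      and b: "consistent b0 b0' b b'" "consistent c0 c0' b b'"
      and c: "consistent b0 b0' c c'" "consistent c0 c0' c c'"
      using F by (auto simp: F_def v_def w_def)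
    have b': "consistent b b' b0 b0'" "consistent b b' c0 c0'"
      using b consistent_sym[OF b0 mb] consistent_sym[OF c0 mb] by auto
    show ?thesis
    proof (cases "linked u v \<and> linked u w \<or> linked x v \<and> linked x w")
      case True
      then show ?thesis
        using good[OF linked_sym _ vw mb b0 mc b'(1) c(1)] good[OF linked_sym _ vw mb c0 mc b'(2) c(2)]
        by blast
    next
      \<comment> \<open>Now one of \<open>v\<close>, \<open>w\<close> is linked to \<open>u\<close>
        but not to \<open>x\<close>, and the other to \<open>x\<close> but not to \<open>u\<close>:
        the four relations form a 4-cycle without diagonals. Unlinked thick relations share a thin
        perp, so just two perps occur, both thin.\<close>
      case no: False
      have orth_u: "orth u = orth y \<and> orth u \<in> thin" if "y \<in> thick" "\<not> linked u y" for y
        using single_product_orth[OF u that(1)] not_linked[OF uS valency_part_in[OF that(1)] that(2)] by blast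
      have orth_x: "orth x = orth y \<and> orth x \<in> thin" if "y \<in> thick" "\<not> linked x y" for y
        using single_product_orth[OF x that(1)]
          not_linked[OF valency_part_in[OF x] valency_part_in[OF that(1)] that(2)] by blast
      have cases: "linked u y \<or> linked x y" if "y \<in> thick" for y
        using orth_u[OF that] orth_x[OF that] neq by metis
      have "\<not> linked u v \<or> \<not> linked u w" "\<not> linked x v \<or> \<not> linked x w" using no by blast+
      then have th: "orth u \<in> thin" "orth x \<in> thin" using orth_u orth_x v w by blast+
      have vw_orth: "{orth v, orth w} \<subseteq> {orth u, orth x}"
        using no cases[OF v] cases[OF w] orth_u[OF v] orth_u[OF w] orth_x[OF v] orth_x[OF w]
        by blast
      have "orth u \<in> perp_set \<Omega> S" "orth x \<in> perp_set \<Omega> S" using u x unfolding perp_set_def by blast+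
      \<comment> \<open>Otherwise \<open>kleinianI\<close> would apply to these two perps. A
        relation \<open>y\<close> with a third perp is linked to all four corners; once
        \<open>d\<close> is consistent with \<open>b0\<close>, the untwisted triangles at
        \<open>y\<close> carry consistency around the cycle.\<close>
      then have "\<not> perp_set \<Omega> S \<subseteq> {orth u, orth x}" using kleinianI th neq nk by blast
      then obtain y where y: "y \<in> thick" "orth y \<notin> {orth u, orth x}" unfolding perp_set_def by blast
      have ly: "linked u y" "linked x y" "linked v y" "linked w y"
        using linked_if_orth_neq[OF _ y(1)] u x v w vw_orth y(2) by (metis insert_iff subset_iff)+
      obtain d where "(\<alpha>, d) \<in> y" using neighbours_nonempty[OF valency_part_in[OF y(1)] base(1)] by blast
      then obtain d' where d: "matched y d d'" and bd: "consistent b0 b0' d d'"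
        using consistent_exists[OF ly(1) b0] by blast
      have cd: "consistent c0 c0' d d'" using good[OF linked_sym[OF ux] ly(1,2) c0 b0 d cb bd] .
      have with_d: "consistent e e' d d'"
        if t: "t \<in> thick" "linked t y" and e: "matched t e e'"
          and "consistent b0 b0' e e'" "consistent c0 c0' e e'" for t e e'
      proof -
        have e': "consistent e e' b0 b0'" "consistent e e' c0 c0'"
          using that consistent_sym[OF b0 e] consistent_sym[OF c0 e] by auto
        show ?thesis
          using cases[OF t(1)] good[OF linked_sym ly(1) t(2) e b0 d e'(1) bd]
            good[OF linked_sym ly(2) t(2) e c0 d e'(2) cd] by blast
      qed
      have 1: "consistent b b' d d'" using with_d[OF v ly(3) mb b] .
      have "consistent c c' d d'" using with_d[OF w ly(4) mc c] .
      then have 2: "consistent d d' c c'" using consistent_sym[OF mc d] by simp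
      show ?thesis using good[OF ly(3) linked_sym[OF ly(4)] vw mb d mc 1 2] .
    qed
  qed
  \<comment> \<open>By \<open>pair\<close>, any selection of candidates satisfying \<open>F\<close>
    is pairwise consistent.\<close>
  define f where "f b = (SOME b'. F b b')" for b
  have F: "F b (f b)" if "b \<in> \<Omega>" for b unfolding f_def using ex[OF that] by (rule someI_ex)
  then have m: "matched (rel \<alpha> b) b (f b)" if "b \<in> \<Omega>" for b using that by (simp add: F_def)
  have f_in: "f b \<in> \<Omega>'" if "b \<in> \<Omega>" for b using m[OF that] matched_points by blast
  have rel: "\<phi> (rel b c) = cod.rel (f b) (f c)" if "b \<in> \<Omega>" "c \<in> \<Omega>" for b c
    using pair[OF F F] that by (simp add: consistent_def)
  have inj: "inj_on f \<Omega>"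
  proof (rule inj_onI)
    fix b c assume bc: "b \<in> \<Omega>" "c \<in> \<Omega>" "f b = f c"
    then have "\<phi> (rel b c) = \<phi> (Id_on \<Omega>)"
      using rel[OF bc(1,2)] cod.rel_refl[OF f_in[OF bc(2)]] image_Id by simp
    then show "b = c" using image_eq_iff[OF rel_in Id_in] rel_eq_Id_iff bc by blast
  qed
  \<comment> \<open>Surjectivity follows by counting: \<open>f\<close> maps each neighbourhood of
    \<alpha> injectively into the corresponding neighbourhood of \<alpha>', which has the same
    size.\<close>
  have "\<Omega>' \<subseteq> f ` \<Omega>"
  proof
    fix y' assume y': "y' \<in> \<Omega>'"
    obtain v where v: "v \<in> S" "cod.rel \<alpha>' y' = \<phi> v"
      using image_surj cod.rel_in[OF base(2) y'] by blast
    have sub: "f ` (v `` {\<alpha>}) \<subseteq> \<phi> v `` {\<alpha>'}"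
    proof
      fix z' assume "z' \<in> f ` (v `` {\<alpha>})"
      then obtain z where z: "(\<alpha>, z) \<in> v" "z' = f z" by blast
      then show "z' \<in> \<phi> v `` {\<alpha>'}"
        using m[of z] in_points[OF v(1) z(1)] rel_eqI[OF v(1) z(1)] by (simp add: matched_def)
    qed
    have "inj_on f (v `` {\<alpha>})" using inj in_points[OF v(1)] by (auto simp: inj_on_def)
    then have "card (f ` (v `` {\<alpha>})) = card (\<phi> v `` {\<alpha>'})"
      using valency_image[OF v(1) base] by (simp add: card_image)
    then have "f ` (v `` {\<alpha>}) = \<phi> v `` {\<alpha>'}"
      using card_subset_eq[OF cod.finite_neighbours[OF image_in[OF v(1)]] sub] by simp
    moreover have "y' \<in> \<phi> v `` {\<alpha>'}" using cod.rel_mem[OF base(2) y'] v(2) by simp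
    ultimately show "y' \<in> f ` \<Omega>" using in_points[OF v(1)] by blast
  qed
  then have "bij_betw f \<Omega> \<Omega>'" using inj f_in by (auto simp: bij_betw_def)
  moreover have "f \<alpha> = \<alpha>'"
    using m[OF base(1)] rel_refl[OF base(1)] image_Id by (auto simp: matched_def)
  ultimately show ?thesis using rel by blast
qed

end

section \<open>The one point extension as transport along the bijection\<close>

theorem theorem8p1:
  fixes \<Omega> :: "'a set" and S :: "'a rel set"
    and \<Omega>' :: "'b set" and S' :: "'b rel set"
    and \<phi> :: "'a rel \<Rightarrow> 'b rel"
  assumes "scheme \<Omega> S"
    and "quasi_thin \<Omega> S"
    and "\<not> kleinian \<Omega> S"
    and "card \<Omega> \<ge> 9"
    and "card (perp_set \<Omega> S) \<ge> 2"
    and "scheme \<Omega>' S'"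
    and "algebraic_isomorphism S S' \<phi>"
    and "\<alpha> \<in> \<Omega>"
    and "\<alpha>' \<in> \<Omega>'"
  shows "\<exists>\<psi>. one_point_extension \<Omega> S \<Omega>' S' \<phi> \<alpha> \<alpha>' \<psi>"
proof -
  interpret quasi_thin_isomorphism \<Omega> S \<Omega>' S' \<phi> \<alpha> \<alpha>'
    by unfold_locales (use assms in auto)
  obtain f where f: "bij_betw f \<Omega> \<Omega>'" "f \<alpha> = \<alpha>'"
    and rel: "\<And>x y. x \<in> \<Omega> \<Longrightarrow> y \<in> \<Omega> \<Longrightarrow> \<phi> (rel x y) = cod.rel (f x) (f y)"
    using exists_inducing_bijection assms by blast
  have eq: "transport f u = \<phi> u" if u: "u \<in> S" for u
  proof (intro Set.set_eqI iffI)
    fix p assume "p \<in> transport f u"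
    then obtain x y where xy: "(x, y) \<in> u" "p = (f x, f y)" by (auto simp: transport_def)
    have "x \<in> \<Omega>" "y \<in> \<Omega>" using in_points[OF u xy(1)] by auto
    then show "p \<in> \<phi> u"
      using rel rel_eqI[OF u xy(1)] cod.rel_mem f(1) xy(2) by (metis bij_betwE)
  next
    fix p assume p: "p \<in> \<phi> u"
    obtain x' y' where p_eq: "p = (x', y')" by (cases p)
    have "x' \<in> f ` \<Omega>" "y' \<in> f ` \<Omega>"
      using cod.in_points[OF image_in[OF u]] p p_eq f(1) by (auto simp: bij_betw_def)
    then obtain x y where xy: "x \<in> \<Omega>" "y \<in> \<Omega>" "p = (f x, f y)" using p_eq by blast
    have "\<phi> (rel x y) = \<phi> u" using rel[OF xy(1,2)] cod.rel_eqI[OF image_in[OF u]] p xy(3) by simp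
    then have "rel x y = u" using image_eq_iff[OF rel_in[OF xy(1,2)] u] by simp
    then have "(x, y) \<in> u" using rel_mem[OF xy(1,2)] by simp
    then show "p \<in> transport f u" using xy(3) by (force simp: transport_def)
  qed
  \<comment> \<open>Thus \<open>f\<close> carries the first scheme onto the second and induces
    \<phi>. It therefore carries one point extension onto the other, and \<open>transport f\<close>
    preserves intersection numbers of arbitrary relations on \<Omega>.\<close>
  have S': "transport f ` S = S'" using bij eq by (auto simp: bij_betw_def)
  have cc: "coherent_configuration \<Omega> S" using assms by (simp add: scheme_def)
  let ?T = "point_extension \<Omega> S \<alpha>"
  have T': "point_extension \<Omega>' S' \<alpha>' = transport f ` ?T"
    using point_extension_transport[OF f(1) cc assms(8)] S' f(2) by simp
  have sub: "?T \<subseteq> Pow (\<Omega> \<times> \<Omega>)"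
    using point_extension_least(1)[OF cc assms(8)] coherent_subset by (auto simp: extends_at_def)
  have "algebraic_isomorphism ?T (transport f ` ?T) (transport f)"
    unfolding algebraic_isomorphism_def
  proof
    show "bij_betw (transport f) ?T (transport f ` ?T)"
      using inj_on_subset[OF inj_on_transport[OF f(1)] sub] by (rule inj_on_imp_bij_betw)
    show "\<forall>u\<in>?T. \<forall>v\<in>?T. \<forall>w\<in>?T. intersection_number u v w =
        intersection_number (transport f u) (transport f v) (transport f w)"
      by (intro ballI transport_intersection_number[OF f(1), symmetric]) (use sub in auto)
  qed
  moreover have "transport f {(\<alpha>, \<alpha>)} = {(\<alpha>', \<alpha>')}" using f(2) by (simp add: transport_def)
  moreover have "transport f u \<subseteq> \<phi> v" if "v \<in> S" "u \<subseteq> v" for u v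
    using eq[OF that(1)] that(2) by (auto simp: transport_def)
  ultimately have "one_point_extension \<Omega> S \<Omega>' S' \<phi> \<alpha> \<alpha>' (transport f)"
    by (simp add: one_point_extension_def T')
  then show ?thesis by (rule exI[where x = "transport f"])
qed

end
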